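(* Let $D^-$ be the additive code defined in the context and $E=(D^-)^\perp$ its trace dual ($2^{10}$ codewords, nonzero weights $6,8,10$). On $E$ define relations $R_0=\{(x,x)\}$ and, for $i=1,2,3$, $R_i=\{(x,y)\in E^2:\mathrm{wt}(x+y)=w_i\}$ with $w_1=6,w_2=8,w_3=10$. Then $(E;R_0,R_1,R_2,R_3)$ (the Delsarte dual of the association scheme underlying the coset graph of $D^-$) is a $Q$-polynomial association scheme with Krein array $\{33,30,15;1,2,15\}$, multiplicities $1,33,495,495$ and valencies $1,198,495,330$. Moreover the graph $(E,R_2)$ (two codewords adjacent iff their difference has weight $8$) is strongly regular with parameters $(2^{10},495,238,240)$.
   Context: $\mathbb{F}_4=\{0,1,\omega,\omega^2\}$ with $\omega^2=\omega+1$; $\mathrm{Tr}(z)=z+z^2$. The dual of an additive code $C\subseteq\mathbb{F}_4^n$ is $C^\perp=\{y:\sum_i\mathrm{Tr}(x_iy_i^2)=0\ \forall x\in C\}$. $\mathrm{wt}$ is Hamming weight. $D^-$ is the $\mathbb{F}_2$-span of the following $12$ vectors of $\mathbb{F}_4^{11}$: $(0,0,0,0,0,\omega^2,\omega^2,0,\omega,1,\omega)$, $(0,0,0,0,0,\omega,0,\omega,\omega,\omega,1)$, $(1,0,0,0,0,1,0,1,\omega^2,\omega^2,1)$, $(\omega,0,0,0,0,0,\omega,1,\omega,\omega,\omega)$, $(0,1,0,0,0,0,1,1,1,\omega^2,\omega^2)$, $(0,\omega,0,0,0,\omega^2,1,\omega^2,\omega,\omega,0)$, $(0,0,1,0,0,\omega,\omega,1,1,0,1)$,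 $(0,0,\omega,0,0,\omega,1,\omega,\omega^2,\omega^2,0)$, $(0,0,0,1,0,\omega,\omega,\omega,0,1,\omega)$, $(0,0,0,\omega,0,\omega^2,1,1,\omega^2,0,\omega)$, $(0,0,0,0,1,\omega^2,\omega^2,\omega^2,1,0,\omega^2)$, $(0,0,0,0,\omega,\omega,1,0,1,\omega,\omega)$. Strongly regular parameters $(\nu,\kappa,\lambda,\mu)$: vertices, degree, common neighbours of adjacent pairs, of non-adjacent pairs. *)

theory Defs
  imports
    "HOL-Analysis.Cartesian_Euclidean_Space"
    "HOL-Library.Z2"
    "HOL-Library.Function_Algebras"
    "HOL-Library.Disjoint_Sets"
begin

text \<open>\<open>GF4 a b\<close> stands for $a + b\omega$; the product is reduced by $\omega^2 = \omega + 1$.\<close>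

datatype gf4 = GF4 (gf4_re: bit) (gf4_om: bit)

lemma bit_exhaust: "(b::bit) = 0 \<or> b = 1"
  by (cases b) auto

instantiation gf4 :: field
begin

definition zero_gf4 :: gf4 where "0 = GF4 0 0"

definition one_gf4 :: gf4 where "1 = GF4 1 0"

definition plus_gf4 :: "gf4 \<Rightarrow> gf4 \<Rightarrow> gf4" where
  "x + y = GF4 (gf4_re x + gf4_re y) (gf4_om x + gf4_om y)"

definition uminus_gf4 :: "gf4 \<Rightarrow> gf4" where "- x = (x::gf4)"

definition minus_gf4 :: "gf4 \<Rightarrow> gf4 \<Rightarrow> gf4" where "x - y = x + (y::gf4)"

definition times_gf4 :: "gf4 \<Rightarrow> gf4 \<Rightarrow> gf4" where
  "x * y = GF4 (gf4_re x * gf4_re y + gf4_om x * gf4_om y)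
    (gf4_re x * gf4_om y + gf4_om x * gf4_re y + gf4_om x * gf4_om y)"

text \<open>Every nonzero element satisfies $x^3 = 1$.\<close>

definition inverse_gf4 :: "gf4 \<Rightarrow> gf4" where "inverse x = x * (x::gf4)"

definition divide_gf4 :: "gf4 \<Rightarrow> gf4 \<Rightarrow> gf4" where "x div y = x * inverse (y::gf4)"

instance
proof
  note defs = zero_gf4_def one_gf4_def plus_gf4_def uminus_gf4_def minus_gf4_def
    times_gf4_def inverse_gf4_def divide_gf4_def
  fix a b c :: gf4
  show "a + b + c = a + (b + c)" "a + b = b + a" by (simp_all only: defs gf4.sel ac_simps)
  show "0 + a = a" "1 * a = a" "inverse (0::gf4) = 0"
    by (cases a; simp add: defs)+
  show "- a + a = 0" by (simp add: defs)
  show "a - b = a + - b" "a div b = a * inverse b" "(0::gf4) \<noteq> 1" by (simp_all add: defs)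
  show "a * b = b * a" by (simp only: defs gf4.sel ac_simps)
  show "a * b * c = a * (b * c)" "(a + b) * c = a * c + b * c"
    by (simp_all only: defs gf4.sel algebra_simps)
  show "a \<noteq> 0 \<Longrightarrow> inverse a * a = 1"
    using bit_exhaust[of "gf4_re a"] bit_exhaust[of "gf4_om a"]
    by (cases a) (auto simp: defs)
qed

end

definition omega :: gf4  ("\<omega>") where "\<omega> = GF4 0 1"

lemma omega_square: "\<omega>\<^sup>2 = \<omega> + 1"
  by (simp add: omega_def power2_eq_square times_gf4_def plus_gf4_def one_gf4_def)

lemma UNIV_gf4: "(UNIV :: gf4 set) = {0, 1, \<omega>, \<omega>\<^sup>2}"
proof -
  have "x \<in> {0, 1, \<omega>, \<omega> + 1}" for x :: gf4
  proof (cases x)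
    case (GF4 a b)
    then show ?thesis
      using bit_exhaust[of a] bit_exhaust[of b]
      by (auto simp: zero_gf4_def one_gf4_def omega_def plus_gf4_def)
  qed
  then show ?thesis by (auto simp: omega_square)
qed

instance gf4 :: finite
  by standard (simp add: UNIV_gf4)


definition gf4_trace :: "gf4 \<Rightarrow> gf4" where
  "gf4_trace z = z + z\<^sup>2"

definition trace_form :: "gf4 ^ 'n \<Rightarrow> gf4 ^ 'n \<Rightarrow> gf4" where
  "trace_form x y = (\<Sum>i\<in>UNIV. gf4_trace (x $ i * (y $ i)\<^sup>2))"

definition trace_dual :: "(gf4 ^ 'n) set \<Rightarrow> (gf4 ^ 'n) set" where
  "trace_dual C = {y. \<forall>x\<in>C. trace_form x y = 0}"

definition hamming_weight :: "gf4 ^ 'n \<Rightarrow> nat" where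
  "hamming_weight x = card {i. x $ i \<noteq> 0}"

definition f2_scale :: "bit \<Rightarrow> gf4 ^ 'n \<Rightarrow> gf4 ^ 'n" where
  "f2_scale b v = (if b = 0 then 0 else v)"

lemma gf4_vec_add_self: "v + v = (0 :: gf4 ^ 'n)"
proof -
  have "a + a = 0" for a :: gf4
    by (metis minus_gf4_def right_minus_eq)
  then show ?thesis by (simp only: vec_eq_iff vector_add_component zero_index) simp
qed

interpretation f2: vector_space "f2_scale :: bit \<Rightarrow> gf4 ^ 'n \<Rightarrow> gf4 ^ 'n"
proof
  fix a b :: bit and x y :: "gf4 ^ 'n"
  show "f2_scale a (x + y) = f2_scale a x + f2_scale a y" by (simp add: f2_scale_def)
  show "f2_scale (a + b) x = f2_scale a x + f2_scale b x"
    using bit_exhaust[of a] bit_exhaust[of b] by (auto simp: f2_scale_def gf4_vec_add_self)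
  show "f2_scale a (f2_scale b x) = f2_scale (a * b) x"
    using bit_exhaust[of a] bit_exhaust[of b] by (auto simp: f2_scale_def)
  show "f2_scale 1 x = x" by (simp add: f2_scale_def)
qed

definition D_minus :: "(gf4 ^ 11) set" where
  "D_minus = f2.span {
    vector [0, 0, 0, 0, 0, \<omega>\<^sup>2, \<omega>\<^sup>2, 0, \<omega>, 1, \<omega>],
    vector [0, 0, 0, 0, 0, \<omega>, 0, \<omega>, \<omega>, \<omega>, 1],
    vector [1, 0, 0, 0, 0, 1, 0, 1, \<omega>\<^sup>2, \<omega>\<^sup>2, 1],
    vector [\<omega>, 0, 0, 0, 0, 0, \<omega>, 1, \<omega>, \<omega>, \<omega>],
    vector [0, 1, 0, 0, 0, 0, 1, 1, 1, \<omega>\<^sup>2, \<omega>\<^sup>2],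
    vector [0, \<omega>, 0, 0, 0, \<omega>\<^sup>2, 1, \<omega>\<^sup>2, \<omega>, \<omega>, 0],
    vector [0, 0, 1, 0, 0, \<omega>, \<omega>, 1, 1, 0, 1],
    vector [0, 0, \<omega>, 0, 0, \<omega>, 1, \<omega>, \<omega>\<^sup>2, \<omega>\<^sup>2, 0],
    vector [0, 0, 0, 1, 0, \<omega>, \<omega>, \<omega>, 0, 1, \<omega>],
    vector [0, 0, 0, \<omega>, 0, \<omega>\<^sup>2, 1, 1, \<omega>\<^sup>2, 0, \<omega>],
    vector [0, 0, 0, 0, 1, \<omega>\<^sup>2, \<omega>\<^sup>2, \<omega>\<^sup>2, 1, 0, \<omega>\<^sup>2],
    vector [0, 0, 0, 0, \<omega>, \<omega>, 1, 0, 1, \<omega>, \<omega>]}"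

definition E_code :: "(gf4 ^ 11) set" where
  "E_code = trace_dual D_minus"

definition E_rel :: "nat \<Rightarrow> ((gf4 ^ 11) \<times> (gf4 ^ 11)) set" where
  "E_rel i = (if i = 0 then {(x, x) | x. x \<in> E_code}
     else {(x, y). x \<in> E_code \<and> y \<in> E_code \<and> hamming_weight (x + y) = [6, 8, 10] ! (i - 1)})"


text \<open>Symmetric association schemes with \<open>d\<close> classes on the finite set \<open>X\<close>;
  only the relations \<open>R 0, \<dots>, R d\<close> matter.\<close>

definition association_scheme :: "'a set \<Rightarrow> nat \<Rightarrow> (nat \<Rightarrow> ('a \<times> 'a) set) \<Rightarrow> bool" where
  "association_scheme X d R \<longleftrightarrow>
     finite X \<and> X \<noteq> {} \<and>
     R 0 = Id_on X \<and>
     (\<forall>i\<le>d. R i \<noteq> {}) \<and>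
     disjoint_family_on R {..d} \<and>
     (\<Union>i\<le>d. R i) = X \<times> X \<and>
     (\<forall>i\<le>d. sym (R i)) \<and>
     (\<forall>i\<le>d. \<forall>j\<le>d. \<forall>k\<le>d. \<exists>p. \<forall>(x, y)\<in>R k.
        card {z \<in> X. (x, z) \<in> R i \<and> (z, y) \<in> R j} = p)"

definition has_valency :: "'a set \<Rightarrow> ('a \<times> 'a) set \<Rightarrow> nat \<Rightarrow> bool" where
  "has_valency X S k \<longleftrightarrow> (\<forall>x\<in>X. card {y \<in> X. (x, y) \<in> S} = k)"

text \<open>Real matrices with rows and columns indexed by \<open>X\<close> are functions vanishing outside
  \<open>X \<times> X\<close>.\<close>

type_synonym 'a rmat = "'a \<Rightarrow> 'a \<Rightarrow> real"

definition rmat_mult :: "'a set \<Rightarrow> 'a rmat \<Rightarrow> 'a rmat \<Rightarrow> 'a rmat" where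
  "rmat_mult X M N = (\<lambda>x y. \<Sum>z\<in>X. M x z * N z y)"

definition adjacency_matrix :: "('a \<times> 'a) set \<Rightarrow> 'a rmat" where
  "adjacency_matrix S = (\<lambda>x y. if (x, y) \<in> S then 1 else 0)"

definition bose_mesner :: "nat \<Rightarrow> (nat \<Rightarrow> ('a \<times> 'a) set) \<Rightarrow> 'a rmat set" where
  "bose_mesner d R = {\<lambda>x y. \<Sum>i\<le>d. c i * adjacency_matrix (R i) x y | c. True}"

definition primitive_idempotent ::
    "'a set \<Rightarrow> nat \<Rightarrow> (nat \<Rightarrow> ('a \<times> 'a) set) \<Rightarrow> 'a rmat \<Rightarrow> bool" where
  "primitive_idempotent X d R e \<longleftrightarrow>
     e \<in> bose_mesner d R \<and> e \<noteq> (\<lambda>x y. 0) \<and> rmat_mult X e e = e \<and>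
     (\<forall>f\<in>bose_mesner d R. rmat_mult X f f = f \<and> rmat_mult X e f = f \<longrightarrow> f = (\<lambda>x y. 0) \<or> f = e)"

definition idempotent_ordering ::
    "'a set \<Rightarrow> nat \<Rightarrow> (nat \<Rightarrow> ('a \<times> 'a) set) \<Rightarrow> (nat \<Rightarrow> 'a rmat) \<Rightarrow> bool" where
  "idempotent_ordering X d R e \<longleftrightarrow>
     bij_betw e {..d} {f. primitive_idempotent X d R f} \<and>
     e 0 = (\<lambda>x y. if x \<in> X \<and> y \<in> X then 1 / real (card X) else 0)"

text \<open>\<open>q i j k\<close> is the Krein parameter $q_{ij}^k$, defined by
  $E_i \circ E_j = |X|^{-1} \sum_k q_{ij}^k E_k$ with the entrywise product $\circ$.\<close>

definition krein_parameters ::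
    "'a set \<Rightarrow> nat \<Rightarrow> (nat \<Rightarrow> 'a rmat) \<Rightarrow> (nat \<Rightarrow> nat \<Rightarrow> nat \<Rightarrow> real) \<Rightarrow> bool" where
  "krein_parameters X d e q \<longleftrightarrow>
     (\<forall>i\<le>d. \<forall>j\<le>d. \<forall>x\<in>X. \<forall>y\<in>X.
        e i x y * e j x y = 1 / real (card X) * (\<Sum>k\<le>d. q i j k * e k x y))"

definition Q_polynomial ::
    "'a set \<Rightarrow> nat \<Rightarrow> (nat \<Rightarrow> ('a \<times> 'a) set) \<Rightarrow> (nat \<Rightarrow> 'a rmat) \<Rightarrow> bool" where
  "Q_polynomial X d R e \<longleftrightarrow>
     association_scheme X d R \<and> idempotent_ordering X d R e \<and>
     (\<exists>q. krein_parameters X d e q \<and>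
       (\<forall>i\<le>d. \<forall>j\<le>d. \<forall>k\<le>d.
         (i > j + k \<or> j > i + k \<or> k > i + j \<longrightarrow> q i j k = 0) \<and>
         (i = j + k \<or> j = i + k \<or> k = i + j \<longrightarrow> q i j k \<noteq> 0)))"

text \<open>The Krein array $\{b_0^*,\dots,b_{d-1}^*; c_1^*,\dots,c_d^*\}$ with
  $b_i^* = q_{1,i+1}^i$ and $c_i^* = q_{1,i-1}^i$.\<close>

definition has_krein_array ::
    "'a set \<Rightarrow> nat \<Rightarrow> (nat \<Rightarrow> 'a rmat) \<Rightarrow> real list \<Rightarrow> real list \<Rightarrow> bool" where
  "has_krein_array X d e bs cs \<longleftrightarrow>
     length bs = d \<and> length cs = d \<and>
     (\<exists>q. krein_parameters X d e q \<and>
       (\<forall>i<d. q 1 (i + 1) i = bs ! i) \<and>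
       (\<forall>i\<in>{1..d}. q 1 (i - 1) i = cs ! (i - 1)))"

definition fun_scale :: "real \<Rightarrow> ('a \<Rightarrow> real) \<Rightarrow> 'a \<Rightarrow> real" where
  "fun_scale c f = (\<lambda>x. c * f x)"

interpretation fun_vs: vector_space "fun_scale :: real \<Rightarrow> ('a \<Rightarrow> real) \<Rightarrow> 'a \<Rightarrow> real"
  by standard (auto simp: fun_scale_def fun_eq_iff algebra_simps)

definition column_space :: "'a set \<Rightarrow> 'a rmat \<Rightarrow> ('a \<Rightarrow> real) set" where
  "column_space X M = fun_vs.span ((\<lambda>y x. M x y) ` X)"

text \<open>The multiplicity of a primitive idempotent is its rank, the dimension of its eigenspace.\<close>

definition multiplicity_of :: "'a set \<Rightarrow> 'a rmat \<Rightarrow> nat" where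
  "multiplicity_of X M = fun_vs.dim (column_space X M)"


definition cosets :: "(gf4 ^ 'n) set \<Rightarrow> (gf4 ^ 'n) set set" where
  "cosets C = range (\<lambda>v. (+) v ` C)"

definition coset_graph :: "(gf4 ^ 'n) set \<Rightarrow> ((gf4 ^ 'n) set \<times> (gf4 ^ 'n) set) set" where
  "coset_graph C = {(A, B). A \<in> cosets C \<and> B \<in> cosets C \<and> A \<noteq> B \<and>
     (\<exists>a\<in>A. \<exists>b\<in>B. hamming_weight (a - b) = 1)}"

definition distance_rel :: "'a set \<Rightarrow> ('a \<times> 'a) set \<Rightarrow> nat \<Rightarrow> ('a \<times> 'a) set" where
  "distance_rel V adj i =
     {(x, y). x \<in> V \<and> y \<in> V \<and> (x, y) \<in> adj ^^ i \<and> (\<forall>j<i. (x, y) \<notin> adj ^^ j)}"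

text \<open>For \<open>y \<in> trace_dual C\<close> this is the character $v + C \mapsto (-1)^{\langle v, y\rangle}$ of the
  quotient group, independent of the representative; every character arises in this way from
  exactly one such \<open>y\<close>.\<close>

definition coset_character :: "(gf4 ^ 'n) set \<Rightarrow> gf4 ^ 'n \<Rightarrow> (gf4 ^ 'n) set \<Rightarrow> real" where
  "coset_character C y A =
     (if A \<in> cosets C then (if trace_form (SOME a. a \<in> A) y = 0 then 1 else - 1) else 0)"

text \<open>The Delsarte dual of a translation scheme \<open>S\<close> on the group of cosets of \<open>C\<close>: two characters
  are in the \<open>j\<close>-th dual relation iff their quotient lies in the \<open>j\<close>-th eigenspace of \<open>S\<close>.
  Characters are identified with elements of \<open>trace_dual C\<close>.\<close>

definition delsarte_dual ::
    "(gf4 ^ 'n) set \<Rightarrow> nat \<Rightarrow> (nat \<Rightarrow> ((gf4 ^ 'n) set \<times> (gf4 ^ 'n) set) set) \<Rightarrow>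
     (nat \<Rightarrow> ((gf4 ^ 'n) \<times> (gf4 ^ 'n)) set) \<Rightarrow> bool" where
  "delsarte_dual C d S T \<longleftrightarrow>
     (\<exists>f. idempotent_ordering (cosets C) d S f \<and>
       (\<forall>j\<le>d. T j = {(x, y). x \<in> trace_dual C \<and> y \<in> trace_dual C \<and>
          coset_character C (x - y) \<in> column_space (cosets C) (f j)}))"


definition strongly_regular :: "'a set \<Rightarrow> ('a \<times> 'a) set \<Rightarrow> nat \<Rightarrow> nat \<Rightarrow> nat \<Rightarrow> nat \<Rightarrow> bool" where
  "strongly_regular V adj n k l m \<longleftrightarrow>
     finite V \<and> adj \<subseteq> V \<times> V \<and> sym adj \<and> irrefl adj \<and>
     card V = n \<and>
     (\<forall>x\<in>V. card {z \<in> V. (x, z) \<in> adj} = k) \<and>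
     (\<forall>x\<in>V. \<forall>y\<in>V. x \<noteq> y \<longrightarrow>
        card {z \<in> V. (x, z) \<in> adj \<and> (y, z) \<in> adj} = (if (x, y) \<in> adj then l else m))"

end

theory Submission
  imports Defs "HOL-Computational_Algebra.Polynomial"
begin

text \<open>
  Write $E = (D^-)^\perp$ and let $\chi(A, y) = \pm 1$ be the pairing of the cosets $A$ of $D^-$ with
  the codewords $y \in E$. A character table with orthogonal columns, a partition of the columns
  whose class sums depend only on a partition of the pairs of rows, and the invertibility of the
  resulting matrix $Q$ already force the row partition to be an association scheme with
  primitive idempotents given by $Q$: all its parameters are read off $Q$ and $P = |E| Q^{-1}$.
  This is applied to the table $\chi$ and to its transpose.

  The class sums over cosets of weight $k \le 2$ are Krawtchouk values at the weights of $E$, as soon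
  as distinct vectors of weight at most $2$ lie in distinct cosets. Let $f(y)$ be the sum of
  $\chi(v, y)$ over the $529$ vectors $v$ of weight at most $2$. The number of pairs $(u, v)$ of such
  vectors with $u + v \in D^-$ is $|E|^{-1} \sum_{y \in E} f(y)^2$, and the weight distribution of
  $E$ makes this $529$, which leaves only the pairs $u = v$.
  All remaining cosets form the third class, whose sums follow by orthogonality.
\<close>

section \<open>Association schemes from character tables\<close>

text \<open>Only the 1024 words of \<open>E_code\<close> are ever enumerated; what is needed about
  the 4096 words of \<open>D_minus\<close> follows from that enumeration through characters. Both
  orientations of the table are needed: rows \<open>E_code\<close> give the scheme of the statement,
  rows \<open>cosets D_minus\<close> give the scheme of which it is the Delsarte dual. Passing from
  one to the other exchanges \<open>P_matrix\<close> and \<open>Q_matrix\<close>, so the Krein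
  parameters of \<open>E_code\<close> are the intersection numbers of the coset graph. The Krein
  array {33,30,15;1,2,15} is the intersection array of that graph, and the Q-polynomial property
  mirrors its distance-regularity. The coset classes are cut out by minimum weight; that they are
  also the distances in the coset graph is derived afterwards from the intersection numbers. Strong
  regularity of the weight 8 relation has a single cause: column 2 of \<open>P_matrix\<close> is
  495, 15, -17, 15, with only two values besides the degree.\<close>

lemma sum_fun_apply: "(\<Sum>i\<in>A. f i) x = (\<Sum>i\<in>A. f i x)"
  by (induction A rule: infinite_finite_induct) auto

text \<open>
  \<open>ch\<close> is the character table with rows \<open>X\<close> and columns \<open>Y\<close>; \<open>cl\<close> is the class of a pair of rows and
  \<open>cy\<close> the class of a column. No group structure is needed: translation invariance enters only
  through the hypothesis on the class sums.
\<close>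

locale dual_eigenmatrices =
  fixes X :: "'a set" and Y :: "'b set" and ch :: "'a \<Rightarrow> 'b \<Rightarrow> real"
    and d :: nat and R :: "nat \<Rightarrow> ('a \<times> 'a) set"
    and cl :: "'a \<Rightarrow> 'a \<Rightarrow> nat" and cy :: "'b \<Rightarrow> nat"
    and P Q :: "nat \<Rightarrow> nat \<Rightarrow> real"
  assumes finite_X: "finite X" and X_nonempty: "X \<noteq> {}" and finite_Y: "finite Y"
    and R_eq: "i \<le> d \<Longrightarrow> R i = {(x, x'). x \<in> X \<and> x' \<in> X \<and> cl x x' = i}"
    and R_nonempty: "i \<le> d \<Longrightarrow> R i \<noteq> {}"
    and cl_le: "x \<in> X \<Longrightarrow> x' \<in> X \<Longrightarrow> cl x x' \<le> d"
    and cl_commute: "x \<in> X \<Longrightarrow> x' \<in> X \<Longrightarrow> cl x x' = cl x' x"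
    and cl_eq_0_iff: "x \<in> X \<Longrightarrow> x' \<in> X \<Longrightarrow> cl x x' = 0 \<longleftrightarrow> x = x'"
    and cy_surj: "j \<le> d \<Longrightarrow> \<exists>y\<in>Y. cy y = j"
    and ch_square: "x \<in> X \<Longrightarrow> y \<in> Y \<Longrightarrow> ch x y * ch x y = 1"
    and ch_orthogonal: "y \<in> Y \<Longrightarrow> y' \<in> Y \<Longrightarrow>
      (\<Sum>x\<in>X. ch x y * ch x y') = (if y = y' then real (card X) else 0)"
    and ch_class_sum: "x \<in> X \<Longrightarrow> x' \<in> X \<Longrightarrow> j \<le> d \<Longrightarrow>
      (\<Sum>y\<in>{y \<in> Y. cy y = j}. ch x y * ch x' y) = Q (cl x x') j"
    and QP: "k \<le> d \<Longrightarrow> i \<le> d \<Longrightarrow>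
      (\<Sum>j\<le>d. Q k j * P j i) = (if k = i then real (card X) else 0)"
    and Q_trivial: "k \<le> d \<Longrightarrow> Q k 0 = 1"
begin

section \<open>Idempotents of the Bose-Mesner algebra\<close>

definition idem :: "nat \<Rightarrow> 'a rmat" where
  "idem j = (\<lambda>x x'. if x \<in> X \<and> x' \<in> X then Q (cl x x') j / real (card X) else 0)"

text \<open>Coordinates in the basis of idempotents. Matrix multiplication becomes multiplication of
  coefficients, which reduces questions about idempotents to the numbers \<open>a j\<close>.\<close>

definition comb :: "(nat \<Rightarrow> real) \<Rightarrow> 'a rmat" where
  "comb a = (\<lambda>x x'. \<Sum>j\<le>d. a j * idem j x x')"

lemma card_X_pos: "real (card X) > 0"
  using finite_X X_nonempty by (simp add: card_gt_0_iff)

lemma idem_eq_class_sum: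
  assumes "x \<in> X" "x' \<in> X" "j \<le> d"
  shows "idem j x x' = (\<Sum>y\<in>{y \<in> Y. cy y = j}. ch x y * ch x' y) / real (card X)"
  using assms by (simp add: idem_def ch_class_sum)

text \<open>Each idempotent is a sum of rank-one matrices, one for each column of its class. Summing
  over the middle index \<open>z\<close> first brings in column orthogonality: only
  \<open>u = v\<close> survives, and different classes share no column.\<close>

lemma idem_mult:
  assumes "i \<le> d" "j \<le> d"
  shows "rmat_mult X (idem i) (idem j) = (if i = j then idem i else (\<lambda>x y. 0))"
proof (intro ext)
  fix x x'
  let ?n = "real (card X)"
  let ?Y = "\<lambda>j. {y \<in> Y. cy y = j}"
  show "rmat_mult X (idem i) (idem j) x x' = (if i = j then idem i else (\<lambda>x y. 0)) x x'"
  proof (cases "x \<in> X \<and> x' \<in> X")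
    case False
    then show ?thesis by (auto simp: rmat_mult_def idem_def)
  next
    case True
    have "rmat_mult X (idem i) (idem j) x x' =
        (\<Sum>z\<in>X. (\<Sum>u\<in>?Y i. ch x u * ch z u) * (\<Sum>v\<in>?Y j. ch z v * ch x' v) / ?n\<^sup>2)"
      unfolding rmat_mult_def using True assms
      by (intro sum.cong) (simp_all add: idem_eq_class_sum power2_eq_square)
    also have "\<dots> = (\<Sum>z\<in>X. \<Sum>u\<in>?Y i. \<Sum>v\<in>?Y j. ch x u * ch x' v * (ch z u * ch z v)) / ?n\<^sup>2"
      unfolding sum_product sum_divide_distrib by (intro sum.cong refl) (simp add: mult_ac)
    also have "(\<Sum>z\<in>X. \<Sum>u\<in>?Y i. \<Sum>v\<in>?Y j. ch x u * ch x' v * (ch z u * ch z v)) =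
        (\<Sum>u\<in>?Y i. \<Sum>v\<in>?Y j. ch x u * ch x' v * (\<Sum>z\<in>X. ch z u * ch z v))"
      by (simp add: sum_distrib_left sum.swap[of _ _ X])
    also have "\<dots> = (\<Sum>u\<in>?Y i. \<Sum>v\<in>?Y j. if u = v then ch x u * ch x' u * ?n else 0)"
      by (intro sum.cong) (auto simp: ch_orthogonal)
    also have "\<dots> = (if i = j then (\<Sum>u\<in>?Y i. ch x u * ch x' u) * ?n else 0)"
      using finite_Y by (auto simp: sum_distrib_right intro!: sum.neutral)
    finally show ?thesis
      using True assms card_X_pos by (auto simp: idem_eq_class_sum power2_eq_square)
  qed
qed

text \<open>\<open>P j i\<close> is the eigenvalue of \<open>R i\<close> on the \<open>j\<close>-th
  eigenspace; the inversion of \<open>Q\<close> enters here, through \<open>QP\<close>.\<close>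

lemma adjacency_eq_comb:
  assumes "i \<le> d"
  shows "adjacency_matrix (R i) = comb (\<lambda>j. P j i)"
proof (intro ext)
  fix x x'
  show "adjacency_matrix (R i) x x' = comb (\<lambda>j. P j i) x x'"
  proof (cases "x \<in> X \<and> x' \<in> X")
    case False
    then show ?thesis
      using assms by (auto simp: adjacency_matrix_def R_eq comb_def idem_def)
  next
    case True
    then have "comb (\<lambda>j. P j i) x x' = (\<Sum>j\<le>d. Q (cl x x') j * P j i) / real (card X)"
      by (simp add: comb_def idem_def sum_divide_distrib mult_ac)
    then show ?thesis
      using True assms card_X_pos by (auto simp: QP cl_le adjacency_matrix_def R_eq)
  qed
qed

lemma idem_eq_adjacency_sum:
  assumes "j \<le> d"
  shows "idem j = (\<lambda>x x'. \<Sum>i\<le>d. Q i j / real (card X) * adjacency_matrix (R i) x x')"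
proof (intro ext)
  fix x x'
  have "(\<Sum>i\<le>d. Q i j / real (card X) * adjacency_matrix (R i) x x') =
      (\<Sum>i\<le>d. if i = cl x x' then if x \<in> X \<and> x' \<in> X then Q i j / real (card X) else 0 else 0)"
    by (intro sum.cong) (auto simp: adjacency_matrix_def R_eq)
  also have "\<dots> = idem j x x'"
    using cl_le by (auto simp: idem_def)
  finally show "idem j x x' = (\<Sum>i\<le>d. Q i j / real (card X) * adjacency_matrix (R i) x x')" ..
qed

lemma bose_mesner_eq_range_comb: "bose_mesner d R = range comb"
proof (intro set_eqI iffI)
  fix f assume "f \<in> bose_mesner d R"
  then obtain c where "f = (\<lambda>x y. \<Sum>i\<le>d. c i * adjacency_matrix (R i) x y)"
    by (auto simp: bose_mesner_def)
  also have "\<dots> = comb (\<lambda>j. \<Sum>i\<le>d. c i * P j i)"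
    by (auto simp: adjacency_eq_comb comb_def sum_distrib_left sum_distrib_right mult_ac
        intro!: ext sum.swap)
  finally show "f \<in> range comb" by blast
next
  fix f assume "f \<in> range comb"
  then obtain a where "f = comb a" by blast
  also have "\<dots> = (\<lambda>x y. \<Sum>i\<le>d. (\<Sum>j\<le>d. a j * (Q i j / real (card X))) * adjacency_matrix (R i) x y)"
  proof (intro ext)
    fix x y
    have "comb a x y = (\<Sum>j\<le>d. \<Sum>i\<le>d. a j * (Q i j / real (card X)) * adjacency_matrix (R i) x y)"
      unfolding comb_def
      by (intro sum.cong refl) (simp add: idem_eq_adjacency_sum sum_distrib_left mult_ac)
    then show "comb a x y =
        (\<Sum>i\<le>d. (\<Sum>j\<le>d. a j * (Q i j / real (card X))) * adjacency_matrix (R i) x y)"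
      by (subst (asm) sum.swap) (simp add: sum_distrib_right)
  qed
  finally show "f \<in> bose_mesner d R" by (auto simp: bose_mesner_def)
qed

lemma comb_mult: "rmat_mult X (comb a) (comb b) = comb (\<lambda>j. a j * b j)"
proof (intro ext)
  fix x y
  have "rmat_mult X (comb a) (comb b) x y =
      (\<Sum>i\<le>d. \<Sum>j\<le>d. a i * b j * rmat_mult X (idem i) (idem j) x y)"
    (is "_ = ?rhs")
  proof -
    have "rmat_mult X (comb a) (comb b) x y =
        (\<Sum>z\<in>X. \<Sum>i\<le>d. \<Sum>j\<le>d. a i * b j * (idem i x z * idem j z y))"
      unfolding rmat_mult_def comb_def sum_product by (intro sum.cong refl) (simp add: mult_ac)
    also have "\<dots> = ?rhs"
      by (simp add: rmat_mult_def sum_distrib_left sum.swap[of _ _ X])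
    finally show ?thesis .
  qed
  also have "\<dots> = (\<Sum>i\<le>d. \<Sum>j\<le>d. if i = j then a i * b i * idem i x y else 0)"
    by (intro sum.cong) (auto simp: idem_mult)
  finally show "rmat_mult X (comb a) (comb b) x y = comb (\<lambda>j. a j * b j) x y"
    by (simp add: comb_def)
qed

lemma idem_eq_comb: "j \<le> d \<Longrightarrow> idem j = comb (\<lambda>i. if i = j then 1 else 0)"
  by (auto simp: comb_def if_distrib[of "\<lambda>c. c * _"] intro!: ext cong: if_cong)

lemma Q_0_eq_card:
  assumes "j \<le> d"
  shows "Q 0 j = real (card {y \<in> Y. cy y = j})"
proof -
  obtain x where x: "x \<in> X" using X_nonempty by blast
  then have "Q 0 j = (\<Sum>y\<in>{y \<in> Y. cy y = j}. ch x y * ch x y)"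
    using ch_class_sum[OF x x assms] cl_eq_0_iff[OF x x] by simp
  also have "\<dots> = (\<Sum>y\<in>{y \<in> Y. cy y = j}. 1)"
    using x by (intro sum.cong) (auto simp: ch_square)
  finally show ?thesis by simp
qed

lemma idem_nonzero:
  assumes "j \<le> d"
  shows "idem j \<noteq> (\<lambda>x y. 0)"
proof
  assume *: "idem j = (\<lambda>x y. 0)"
  obtain x where x: "x \<in> X" using X_nonempty by blast
  have "card {y \<in> Y. cy y = j} > 0"
    using cy_surj[OF assms] finite_Y by (auto simp: card_gt_0_iff)
  moreover have "idem j x x = Q 0 j / real (card X)"
    using x cl_eq_0_iff[OF x x] by (simp add: idem_def)
  ultimately show False
    using * assms Q_0_eq_card[OF assms] card_X_pos by simp
qed

text \<open>Multiplication by \<open>idem j\<close> isolates the coefficient at \<open>j\<close>,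
  and \<open>idem j\<close> is not the zero matrix.\<close>

lemma comb_inject:
  assumes "comb a = comb b" "j \<le> d"
  shows "a j = b j"
proof -
  have *: "rmat_mult X (comb c) (idem j) = (\<lambda>x y. c j * idem j x y)" for c
  proof -
    have "rmat_mult X (comb c) (idem j) = comb (\<lambda>i. if i = j then c j else 0)"
      unfolding idem_eq_comb[OF assms(2)] comb_mult by (rule arg_cong[where f = comb]) auto
    also have "\<dots> = (\<lambda>x y. c j * idem j x y)"
      using assms(2) by (auto simp: comb_def if_distrib[of "\<lambda>c. c * _"] intro!: ext cong: if_cong)
    finally show ?thesis .
  qed
  obtain x y where "idem j x y \<noteq> 0"
    using idem_nonzero[OF assms(2)] by (auto simp: fun_eq_iff)
  moreover have "a j * idem j x y = b j * idem j x y"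
    using *[of a] *[of b] assms(1) by (metis (no_types))
  ultimately show ?thesis by simp
qed

lemma comb_idempotentD:
  assumes "rmat_mult X (comb a) (comb a) = comb a" "j \<le> d"
  shows "a j = 0 \<or> a j = 1"
  using comb_inject[OF assms(1)[unfolded comb_mult] assms(2)] by simp

lemma primitive_idempotent_idem:
  assumes "j \<le> d"
  shows "primitive_idempotent X d R (idem j)"
  unfolding primitive_idempotent_def
proof (intro conjI ballI impI)
  show "idem j \<in> bose_mesner d R"
    using idem_eq_comb[OF assms] by (simp add: bose_mesner_eq_range_comb)
  show "idem j \<noteq> (\<lambda>x y. 0)" using idem_nonzero[OF assms] .
  show "rmat_mult X (idem j) (idem j) = idem j" using assms by (simp add: idem_mult)
  fix f assume "f \<in> bose_mesner d R"
  then obtain b where f: "f = comb b" by (auto simp: bose_mesner_eq_range_comb)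
  assume "rmat_mult X f f = f \<and> rmat_mult X (idem j) f = f"
  then have b: "rmat_mult X (comb b) (comb b) = comb b"
    "comb (\<lambda>i. (if i = j then 1 else 0) * b i) = comb b"
    by (simp_all add: f idem_eq_comb[OF assms] comb_mult)
  have "b i = 0" if "i \<le> d" "i \<noteq> j" for i
    using comb_inject[OF b(2) that(1)] that by simp
  then have "f = (\<lambda>x y. \<Sum>i\<le>d. if i = j then b j * idem j x y else 0)"
    unfolding f comb_def by (intro ext sum.cong) auto
  then have "f = (\<lambda>x y. b j * idem j x y)" using assms by simp
  then show "f = (\<lambda>x y. 0) \<or> f = idem j"
    using comb_idempotentD[OF b(1) assms] by auto
qed

text \<open>The coefficients of an idempotent are 0 or 1. A coefficient 1 at \<open>j\<close> means
  that \<open>f\<close> absorbs \<open>idem j\<close>, and primitivity then leaves only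
  \<open>f = idem j\<close>.\<close>

lemma primitive_idempotentD:
  assumes "primitive_idempotent X d R f"
  shows "\<exists>j\<le>d. f = idem j"
proof -
  have f: "f \<in> bose_mesner d R" "f \<noteq> (\<lambda>x y. 0)" "rmat_mult X f f = f"
    and min: "\<And>g. g \<in> bose_mesner d R \<Longrightarrow> rmat_mult X g g = g \<Longrightarrow> rmat_mult X f g = g \<Longrightarrow>
      g = (\<lambda>x y. 0) \<or> g = f"
    using assms by (auto simp: primitive_idempotent_def)
  obtain a where a: "f = comb a" using f(1) by (auto simp: bose_mesner_eq_range_comb)
  obtain j where j: "j \<le> d" "a j \<noteq> 0"
    using f(2) by (force simp: a comb_def)
  then have "a j = 1" using comb_idempotentD f(3) a by blast
  then have "rmat_mult X f (idem j) = idem j"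
    unfolding a idem_eq_comb[OF j(1)] comb_mult by (intro arg_cong[where f = comb]) auto
  then have "idem j = f"
    using min[of "idem j"] j primitive_idempotent_idem[OF j(1)] by (auto simp: primitive_idempotent_def)
  then show ?thesis using j by blast
qed

lemma idempotent_ordering_idem: "idempotent_ordering X d R idem"
  unfolding idempotent_ordering_def
proof
  have "inj_on idem {..d}"
  proof (rule inj_onI)
    fix i j assume ij: "i \<in> {..d}" "j \<in> {..d}" "idem i = idem j"
    then have "rmat_mult X (idem i) (idem j) = idem i" by (simp add: idem_mult)
    then show "i = j" using ij idem_mult[of i j] idem_nonzero[of i] by (auto split: if_splits)
  qed
  moreover have "idem ` {..d} = {f. primitive_idempotent X d R f}"
    using primitive_idempotentD primitive_idempotent_idem by auto
  ultimately show "bij_betw idem {..d} {f. primitive_idempotent X d R f}"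
    by (simp add: bij_betw_def)
  show "idem 0 = (\<lambda>x y. if x \<in> X \<and> y \<in> X then 1 / real (card X) else 0)"
    by (intro ext) (simp add: idem_def Q_trivial cl_le)
qed

section \<open>Intersection numbers, valencies and Krein parameters\<close>

lemma card_common:
  assumes "i \<le> d" "j \<le> d" "x \<in> X" "y \<in> X"
  shows "real (card {z \<in> X. cl x z = i \<and> cl z y = j}) =
    (\<Sum>m\<le>d. P m i * P m j * Q (cl x y) m) / real (card X)"
proof -
  have "real (card {z \<in> X. cl x z = i \<and> cl z y = j}) =
      (\<Sum>z\<in>X. if cl x z = i \<and> cl z y = j then 1 else 0)"
    using finite_X by (simp add: sum.If_cases Int_def)
  \<comment> \<open>The count is an entry of a product of adjacency matrices, which has coefficients
    \<open>P m i * P m j\<close> in the basis of idempotents.\<close>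
  also have "\<dots> = rmat_mult X (adjacency_matrix (R i)) (adjacency_matrix (R j)) x y"
    unfolding rmat_mult_def using assms
    by (intro sum.cong) (auto simp: adjacency_matrix_def R_eq)
  also have "\<dots> = (\<Sum>m\<le>d. P m i * P m j * Q (cl x y) m) / real (card X)"
    using assms by (simp add: adjacency_eq_comb comb_mult) (simp add: comb_def idem_def sum_divide_distrib)
  finally show ?thesis .
qed

lemma card_neighbours:
  assumes "i \<le> d" "x \<in> X"
  shows "real (card {y \<in> X. cl x y = i}) = P 0 i"
proof -
  have 0: "cl x x = 0" using assms cl_eq_0_iff by blast
  \<comment> \<open>By \<open>Q_trivial\<close> all entries of \<open>idem 0\<close> on
    \<open>X\<close> are \<open>1 / card X\<close>, so row sums of \<open>idem j\<close> are read
    off the product with \<open>idem 0\<close>, which vanishes unless \<open>j = 0\<close>.\<close>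
  have "(\<Sum>z\<in>X. idem j x z) = (if j = 0 then 1 else 0)" if "j \<le> d" for j
  proof -
    have "(\<Sum>z\<in>X. idem j x z) = real (card X) * rmat_mult X (idem j) (idem 0) x x"
      using assms that card_X_pos cl_le Q_trivial
      by (simp add: rmat_mult_def idem_def sum_distrib_left)
    also have "\<dots> = (if j = 0 then 1 else 0)"
      unfolding idem_mult[OF that le0]
      using assms card_X_pos by (simp add: Q_trivial idem_def 0)
    finally show ?thesis .
  qed
  note * = this
  have "real (card {y \<in> X. cl x y = i}) = (\<Sum>y\<in>X. if cl x y = i then 1 else 0)"
    using finite_X by (simp add: sum.If_cases Int_def)
  also have "\<dots> = (\<Sum>y\<in>X. adjacency_matrix (R i) x y)"
    using assms by (intro sum.cong) (auto simp: adjacency_matrix_def R_eq)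
  also have "\<dots> = (\<Sum>j\<le>d. P j i * (\<Sum>y\<in>X. idem j x y))"
    using assms by (simp add: adjacency_eq_comb comb_def sum_distrib_left sum.swap[of _ X])
  also have "\<dots> = (\<Sum>j\<le>d. if j = 0 then P 0 i else 0)"
    by (intro sum.cong) (auto simp: *)
  finally show ?thesis by simp
qed

lemma association_scheme: "association_scheme X d R"
  unfolding association_scheme_def
proof (intro conjI allI impI)
  show "finite X" "X \<noteq> {}" by (fact finite_X X_nonempty)+
  show "R 0 = Id_on X" using cl_eq_0_iff by (auto simp: R_eq)
  show "R i \<noteq> {}" if "i \<le> d" for i using that by (rule R_nonempty)
  show "disjoint_family_on R {..d}" by (auto simp: disjoint_family_on_def R_eq)
  show "(\<Union>i\<le>d. R i) = X \<times> X" using cl_le by (auto simp: R_eq)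
  show "sym (R i)" if "i \<le> d" for i using that cl_commute by (auto simp: R_eq sym_def)
  fix i j k assume ijk: "i \<le> d" "j \<le> d" "k \<le> d"
  \<comment> \<open>Any fixed pair of \<open>R k\<close> supplies the constant: by
    \<open>card_common\<close> the count depends on a pair only through its class.\<close>
  obtain x0 y0 where 0: "(x0, y0) \<in> R k" using R_nonempty[OF ijk(3)] by auto
  have "card {z \<in> X. (x, z) \<in> R i \<and> (z, y) \<in> R j} =
      card {z \<in> X. (x0, z) \<in> R i \<and> (z, y0) \<in> R j}" if xy: "(x, y) \<in> R k" for x y
  proof -
    have X: "x \<in> X" "y \<in> X" "cl x y = k" "x0 \<in> X" "y0 \<in> X" "cl x0 y0 = k"
      using xy 0 ijk by (auto simp: R_eq)
    then have "real (card {z \<in> X. cl x z = i \<and> cl z y = j}) =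
        real (card {z \<in> X. cl x0 z = i \<and> cl z y0 = j})"
      using ijk by (simp only: card_common)
    then show ?thesis using X ijk by (simp add: R_eq cong: conj_cong)
  qed
  then show "\<exists>p. \<forall>(x, y)\<in>R k. card {z \<in> X. (x, z) \<in> R i \<and> (z, y) \<in> R j} = p" by blast
qed

text \<open>The entrywise product is constant on each class \<open>m\<close>, namely
  \<open>Q m i * Q m j\<close> up to the square of \<open>card X\<close>, and \<open>P\<close>
  expands it in the idempotents again. The formula is that of \<open>card_common\<close> with
  \<open>P\<close> and \<open>Q\<close> exchanged.\<close>

lemma krein_parameters_idem:
  "krein_parameters X d idem (\<lambda>i j k. (\<Sum>m\<le>d. Q m i * Q m j * P k m) / real (card X))"
  unfolding krein_parameters_def
proof (intro allI impI ballI)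
  fix i j x y assume ij: "i \<le> d" "j \<le> d" and xy: "x \<in> X" "y \<in> X"
  let ?n = "real (card X)" and ?c = "cl x y"
  have "(\<Sum>k\<le>d. (\<Sum>m\<le>d. Q m i * Q m j * P k m) / ?n * idem k x y) =
      (\<Sum>k\<le>d. \<Sum>m\<le>d. Q m i * Q m j * (Q ?c k * P k m)) / ?n\<^sup>2"
    unfolding sum_divide_distrib sum_distrib_right
    using xy by (intro sum.cong refl) (simp add: idem_def power2_eq_square)
  also have "\<dots> = (\<Sum>m\<le>d. Q m i * Q m j * (\<Sum>k\<le>d. Q ?c k * P k m)) / ?n\<^sup>2"
    by (subst sum.swap) (simp add: sum_distrib_left)
  also have "\<dots> = (\<Sum>m\<le>d. if m = ?c then Q ?c i * Q ?c j * ?n else 0) / ?n\<^sup>2"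
    using xy cl_le by (intro arg_cong2[where f = "(/)"] sum.cong) (auto simp: QP)
  also have "\<dots> = ?n * (idem i x y * idem j x y)"
    using xy cl_le card_X_pos by (simp add: idem_def power2_eq_square)
  finally show "idem i x y * idem j x y =
      1 / ?n * (\<Sum>k\<le>d. (\<Sum>m\<le>d. Q m i * Q m j * P k m) / ?n * idem k x y)"
    using card_X_pos by simp
qed

section \<open>Eigenspaces and multiplicities\<close>

definition char_fun :: "'b \<Rightarrow> 'a \<Rightarrow> real" where
  "char_fun y = (\<lambda>x. if x \<in> X then ch x y else 0)"

text \<open>The class sum formula writes the columns of \<open>idem j\<close> as combinations of
  characters of class \<open>j\<close>. Conversely \<open>idem j\<close> fixes each such character,
  which is therefore a combination of its columns.\<close>

lemma column_space_idem:
  assumes "j \<le> d"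
  shows "column_space X (idem j) = fun_vs.span (char_fun ` {y \<in> Y. cy y = j})"
  unfolding column_space_def
proof (rule fun_vs.span_eq[THEN iffD2], intro conjI subsetI)
  let ?n = "real (card X)" and ?Y = "{y \<in> Y. cy y = j}"
  fix f assume "f \<in> (\<lambda>y x. idem j x y) ` X"
  then obtain x' where x': "x' \<in> X" "f = (\<lambda>x. idem j x x')" by blast
  have "f = (\<Sum>y\<in>?Y. fun_scale (ch x' y / ?n) (char_fun y))"
  proof
    fix x show "f x = (\<Sum>y\<in>?Y. fun_scale (ch x' y / ?n) (char_fun y)) x"
    proof (cases "x \<in> X")
      case True
      then show ?thesis
        using x' assms by (simp add: sum_fun_apply idem_eq_class_sum fun_scale_def char_fun_def
            sum_divide_distrib mult_ac)
    next
      case False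
      then show ?thesis
        using x' by (simp add: sum_fun_apply fun_scale_def char_fun_def idem_def)
    qed
  qed
  then show "f \<in> fun_vs.span (char_fun ` ?Y)"
    by (simp only:) (intro fun_vs.span_sum fun_vs.span_scale fun_vs.span_base imageI)
next
  let ?n = "real (card X)" and ?Y = "{y \<in> Y. cy y = j}"
  fix f assume "f \<in> char_fun ` ?Y"
  then obtain y where y: "y \<in> Y" "cy y = j" "f = char_fun y" by blast
  have "f = (\<Sum>x'\<in>X. fun_scale (ch x' y) (\<lambda>x. idem j x x'))"
  proof
    fix x
    show "f x = (\<Sum>x'\<in>X. fun_scale (ch x' y) (\<lambda>x. idem j x x')) x"
    proof (cases "x \<in> X")
      case True
      have "(\<Sum>x'\<in>X. ch x' y * idem j x x') = (\<Sum>x'\<in>X. \<Sum>u\<in>?Y. ch x u * (ch x' u * ch x' y)) / ?n"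
        using True assms by (simp add: idem_eq_class_sum sum_distrib_left sum_divide_distrib mult_ac)
      also have "\<dots> = (\<Sum>u\<in>?Y. ch x u * (\<Sum>x'\<in>X. ch x' u * ch x' y)) / ?n"
        by (subst sum.swap) (simp add: sum_distrib_left)
      also have "\<dots> = (\<Sum>u\<in>?Y. if u = y then ch x y * ?n else 0) / ?n"
        using y by (intro arg_cong2[where f = "(/)"] sum.cong) (auto simp: ch_orthogonal)
      also have "\<dots> = ch x y" using y finite_Y card_X_pos by simp
      finally show ?thesis using True y by (simp add: sum_fun_apply fun_scale_def char_fun_def)
    qed (simp add: y sum_fun_apply fun_scale_def char_fun_def idem_def)
  qed
  then show "f \<in> fun_vs.span ((\<lambda>y x. idem j x y) ` X)"
    by (simp only:) (intro fun_vs.span_sum fun_vs.span_scale fun_vs.span_base imageI)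
qed

text \<open>Pairing with column \<open>y\<close> is a linear functional that kills all other
  characters but not \<open>char_fun y\<close>. This gives both the injectivity of
  \<open>char_fun\<close> on a class and linear independence.\<close>

lemma char_fun_not_in_span:
  assumes "y \<in> Y" "S \<subseteq> Y - {y}"
  shows "char_fun y \<notin> fun_vs.span (char_fun ` S)"
proof
  let ?K = "{f. (\<Sum>x\<in>X. f x * ch x y) = 0}"
  have "fun_vs.subspace ?K"
    by (auto simp: fun_vs.subspace_def fun_scale_def distrib_right sum.distrib
        sum_distrib_left[symmetric] mult.assoc)
  moreover have "char_fun ` S \<subseteq> ?K"
  proof clarify
    fix s assume "s \<in> S"
    then have "s \<in> Y" "s \<noteq> y" using assms(2) by auto
    then have "(\<Sum>x\<in>X. ch x s * ch x y) = 0" using assms(1) by (simp add: ch_orthogonal)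
    then show "(\<Sum>x\<in>X. char_fun s x * ch x y) = 0" by (simp add: char_fun_def)
  qed
  ultimately have "fun_vs.span (char_fun ` S) \<subseteq> ?K" by (rule fun_vs.span_minimal[rotated])
  moreover assume "char_fun y \<in> fun_vs.span (char_fun ` S)"
  ultimately have "(\<Sum>x\<in>X. char_fun y x * ch x y) = 0" by blast
  then have "(\<Sum>x\<in>X. ch x y * ch x y) = 0" by (simp add: char_fun_def)
  then show False using assms ch_orthogonal[of y y] card_X_pos by simp
qed

lemma char_fun_in_column_space_iff:
  assumes "j \<le> d" "y \<in> Y"
  shows "char_fun y \<in> column_space X (idem j) \<longleftrightarrow> cy y = j"
  using assms char_fun_not_in_span[of y "{y \<in> Y. cy y = j}"]
  by (auto simp: column_space_idem intro: fun_vs.span_base)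

lemma multiplicity_of_idem:
  assumes "j \<le> d"
  shows "real (multiplicity_of X (idem j)) = Q 0 j"
proof -
  let ?Y = "{y \<in> Y. cy y = j}"
  have inj: "inj_on char_fun ?Y"
  proof (rule inj_onI, rule ccontr)
    fix u v assume "u \<in> ?Y" "v \<in> ?Y" "char_fun u = char_fun v" "u \<noteq> v"
    then show False
      using char_fun_not_in_span[of u "{v}"] fun_vs.span_base[of "char_fun v" "{char_fun v}"] by auto
  qed
  have "fun_vs.independent (char_fun ` ?Y)"
    unfolding fun_vs.dependent_def
  proof clarify
    fix y assume y: "y \<in> Y" "j = cy y"
      "char_fun y \<in> fun_vs.span (char_fun ` {y' \<in> Y. cy y' = cy y} - {char_fun y})"
    have "char_fun ` {y' \<in> Y. cy y' = cy y} - {char_fun y} \<subseteq>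
        char_fun ` ({y' \<in> Y. cy y' = cy y} - {y})" by auto
    then show False
      using y char_fun_not_in_span[of y "{y' \<in> Y. cy y' = cy y} - {y}"] fun_vs.span_mono by blast
  qed
  then have "fun_vs.dim (fun_vs.span (char_fun ` ?Y)) = card (char_fun ` ?Y)"
    by (metis fun_vs.dim_span fun_vs.dim_eq_card_independent)
  then show ?thesis
    using assms by (simp add: multiplicity_of_def column_space_idem Q_0_eq_card card_image[OF inj])
qed

end

section \<open>Additive codes over the field with four elements\<close>

lemma gf4_add_self: "(a :: gf4) + a = 0"
  by (metis minus_gf4_def right_minus_eq)

lemma gf4_vec_diff_eq_add: "x - y = (x + y :: gf4 ^ 'n)"
  by (simp add: vec_eq_iff minus_gf4_def)

lemma gf4_vec_add_add_cancel: "x + (x + y) = (y :: gf4 ^ 'n)"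
  by (simp add: gf4_vec_add_self flip: add.assoc)

lemma gf4_vec_add_eq_0_iff: "x + y = (0 :: gf4 ^ 'n) \<longleftrightarrow> x = y"
  by (metis gf4_vec_diff_eq_add right_minus_eq)

lemma gf4_square_add: "(u + v)\<^sup>2 = u\<^sup>2 + (v :: gf4)\<^sup>2"
  using gf4_add_self[of "u * v"] by (simp add: power2_eq_square algebra_simps)

lemma sum_gf4:
  fixes f :: "gf4 \<Rightarrow> 'a::comm_monoid_add"
  shows "(\<Sum>a\<in>UNIV. f a) = f 0 + (f 1 + (f \<omega> + f (\<omega>\<^sup>2)))"
proof -
  have "distinct [0, 1, \<omega>, \<omega>\<^sup>2]"
    by (simp add: omega_def power2_eq_square times_gf4_def zero_gf4_def one_gf4_def)
  then show ?thesis by (simp add: UNIV_gf4)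
qed

lemma trace_form_add_left: "trace_form (x + y) z = trace_form x z + trace_form y z"
  by (simp add: trace_form_def gf4_trace_def distrib_right sum.distrib gf4_square_add add_ac)

lemma gf4_trace_cases: "gf4_trace z = 0 \<or> gf4_trace z = 1"
proof -
  have "z \<in> {0, 1, \<omega>, \<omega>\<^sup>2}" using UNIV_gf4 by blast
  then show ?thesis
    by (auto simp: gf4_trace_def omega_def power2_eq_square times_gf4_def plus_gf4_def
        zero_gf4_def one_gf4_def)
qed

text \<open>The trace is invariant under squaring, and the square of \<open>a * b\<^sup>2\<close> is
  \<open>b * a\<^sup>2\<close> because the fourth power of \<open>b\<close> is
  \<open>b\<close>.\<close>

lemma gf4_trace_commute: "gf4_trace (a * b\<^sup>2) = gf4_trace (b * a\<^sup>2)"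
proof -
  have "a = 0 \<or> a = 1 \<or> a = \<omega> \<or> a = \<omega>\<^sup>2" "b = 0 \<or> b = 1 \<or> b = \<omega> \<or> b = \<omega>\<^sup>2"
    using UNIV_gf4 by blast+
  then show ?thesis
    by (elim disjE; simp only:)
      (simp_all add: gf4_trace_def omega_def power2_eq_square times_gf4_def plus_gf4_def
        zero_gf4_def one_gf4_def)
qed

lemma trace_form_commute: "trace_form x y = trace_form y x"
  by (simp add: trace_form_def gf4_trace_commute)

lemma trace_form_add_right: "trace_form z (x + y) = trace_form z x + trace_form z y"
  by (simp add: trace_form_commute[of z] trace_form_add_left)

lemma trace_form_zero_left: "trace_form 0 y = 0"
  by (simp add: trace_form_def gf4_trace_def)

definition pairing_sign :: "gf4 ^ 'n \<Rightarrow> gf4 ^ 'n \<Rightarrow> real" where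
  "pairing_sign x y = (if trace_form x y = 0 then 1 else - 1)"

lemma pairing_sign_commute: "pairing_sign x y = pairing_sign y x"
  by (simp add: pairing_sign_def trace_form_commute)

lemma trace_form_zero_right: "trace_form y 0 = 0"
  by (simp add: trace_form_commute[of y] trace_form_zero_left)

text \<open>That the sum stays in {0, 1} has to be carried through the induction: the sign is
  multiplicative on the prime field but not on all of the field with four elements.\<close>

lemma sign_sum_gf4_01:
  assumes "finite A" "\<And>i. i \<in> A \<Longrightarrow> t i = 0 \<or> t i = (1 :: gf4)"
  shows "(sum t A = 0 \<or> sum t A = 1) \<and>
    (if sum t A = 0 then 1 else - 1 :: real) = (\<Prod>i\<in>A. if t i = 0 then 1 else - 1)"
  using assms
proof (induction A rule: finite_induct)
  case (insert i A)
  then have "(sum t A = 0 \<or> sum t A = 1) \<and>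
    (if sum t A = 0 then 1 else - 1 :: real) = (\<Prod>i\<in>A. if t i = 0 then 1 else - 1)" by blast
  moreover have "t i = 0 \<or> t i = 1" using insert by blast
  ultimately show ?case using insert.hyps gf4_add_self[of 1] by auto
qed simp

lemma pairing_sign_eq_prod:
  "pairing_sign x y = (\<Prod>i\<in>UNIV. if gf4_trace (x $ i * (y $ i)\<^sup>2) = 0 then 1 else - 1)"
  unfolding pairing_sign_def trace_form_def
  using sign_sum_gf4_01[of UNIV "\<lambda>i. gf4_trace (x $ i * (y $ i)\<^sup>2)"] gf4_trace_cases by auto

lemma trace_form_cases: "trace_form x y = 0 \<or> trace_form x y = 1"
  unfolding trace_form_def
  using sign_sum_gf4_01[of UNIV "\<lambda>i. gf4_trace (x $ i * (y $ i)\<^sup>2)"] gf4_trace_cases by auto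

lemma pairing_sign_add_left: "pairing_sign (x + y) z = pairing_sign x z * pairing_sign y z"
  using trace_form_cases[of x z] trace_form_cases[of y z] gf4_add_self[of 1]
  by (auto simp: pairing_sign_def trace_form_add_left)

lemma pairing_sign_add_right: "pairing_sign z (x + y) = pairing_sign z x * pairing_sign z y"
  using pairing_sign_add_left by (simp add: pairing_sign_commute[of z])

section \<open>Hamming weight and Krawtchouk polynomials\<close>

lemma hamming_weight_eq_sum: "hamming_weight x = (\<Sum>i\<in>UNIV. if x $ i = 0 then 0 else 1)"
  by (simp add: hamming_weight_def sum.If_cases Compl_eq)

lemma hamming_weight_eq_0_iff: "hamming_weight x = 0 \<longleftrightarrow> x = 0"
  by (auto simp: hamming_weight_def vec_eq_iff)

lemma hamming_weight_zero [simp]: "hamming_weight 0 = 0"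
  by (simp add: hamming_weight_eq_0_iff)

lemma sum_vec_prod:
  fixes f :: "'n::finite \<Rightarrow> 'a::finite \<Rightarrow> 'b::comm_semiring_1"
  shows "(\<Sum>v\<in>UNIV. \<Prod>i\<in>UNIV. f i (v $ i)) = (\<Prod>i\<in>UNIV. \<Sum>a\<in>UNIV. f i a)"
proof -
  have "(\<Prod>i\<in>UNIV. \<Sum>a\<in>UNIV. f i a) = (\<Sum>g\<in>UNIV. \<Prod>i\<in>UNIV. f i (g i))"
    by (subst prod_sum_PiE) (auto simp: PiE_UNIV_domain)
  also have "\<dots> = (\<Sum>v\<in>UNIV. \<Prod>i\<in>UNIV. f i (v $ i))"
    by (rule sum.reindex_bij_witness[of _ vec_nth vec_lambda]) auto
  finally show ?thesis ..
qed

text \<open>Each coordinate contributes one factor. If \<open>y $ i = 0\<close>, all signs are 1 and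
  the factor is 1 + 3X. Otherwise one nonzero \<open>a\<close> has trace 0 and two have trace 1, so
  the factor is 1 + X - 2X. The exponent of X records the weight, so the coefficients are the
  Krawtchouk values.\<close>

lemma krawtchouk_generating_function:
  fixes y :: "gf4 ^ 'n"
  shows "(\<Sum>v\<in>UNIV. monom (pairing_sign v y) (hamming_weight v)) =
    [:1, 3:] ^ (CARD('n) - hamming_weight y) * [:1, - 1:] ^ hamming_weight y"
proof -
  let ?f = "\<lambda>i a. monom (if gf4_trace (a * (y $ i)\<^sup>2) = 0 then 1 else - 1) (if a = 0 then 0 else 1)
    :: real poly"
  have "monom (pairing_sign v y) (hamming_weight v) = (\<Prod>i\<in>UNIV. ?f i (v $ i))" for v
  proof -
    have "(\<Prod>i\<in>A. monom (c i) (k i)) = monom (\<Prod>i\<in>A. c i) (\<Sum>i\<in>A. k i)"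
      if "finite A" for A :: "'n set" and c :: "'n \<Rightarrow> real" and k
      using that by (induction A rule: finite_induct) (auto simp: mult_monom)
    then show ?thesis by (simp add: pairing_sign_eq_prod hamming_weight_eq_sum)
  qed
  then have "(\<Sum>v\<in>UNIV. monom (pairing_sign v y) (hamming_weight v)) =
      (\<Prod>i\<in>UNIV. \<Sum>a\<in>UNIV. ?f i a)"
    by (simp only: sum_vec_prod[of ?f])
  also have "\<dots> = (\<Prod>i\<in>UNIV. if y $ i = 0 then [:1, 3:] else [:1, - 1:])"
  proof (rule prod.cong)
    fix i
    show "(\<Sum>a\<in>UNIV. ?f i a) = (if y $ i = 0 then [:1, 3:] else [:1, - 1:])"
    proof -
      have "y $ i = 0 \<or> y $ i = 1 \<or> y $ i = \<omega> \<or> y $ i = \<omega>\<^sup>2" using UNIV_gf4 by blast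
      then show ?thesis
        unfolding sum_gf4
        by (elim disjE; simp only:)
          (simp_all add: gf4_trace_def omega_def power2_eq_square times_gf4_def plus_gf4_def
            zero_gf4_def one_gf4_def monom_0 monom_Suc)
    qed
  qed simp
  also have "\<dots> = [:1, 3:] ^ card {i. y $ i = 0} * [:1, - 1:] ^ hamming_weight y"
    by (simp add: prod.If_cases hamming_weight_def Compl_eq)
  also have "card {i. y $ i = 0} = CARD('n) - hamming_weight y"
  proof -
    have "{i. y $ i = 0} = UNIV - {i. y $ i \<noteq> 0}" by auto
    then show ?thesis by (simp add: hamming_weight_def card_Diff_subset)
  qed
  finally show ?thesis .
qed

lemma sum_pairing_sign_weight:
  fixes y :: "gf4 ^ 'n"
  shows "(\<Sum>v\<in>{v. hamming_weight v = k}. pairing_sign v y) =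
    coeff ([:1, 3:] ^ (CARD('n) - hamming_weight y) * [:1, - 1:] ^ hamming_weight y) k"
  unfolding krawtchouk_generating_function[symmetric] coeff_sum
  by (simp add: sum.If_cases Int_def)

lemma sum_pairing_sign_UNIV:
  fixes y :: "gf4 ^ 'n"
  shows "(\<Sum>v\<in>UNIV. pairing_sign v y) = (if y = 0 then 4 ^ CARD('n) else 0)"
proof -
  have "(\<Sum>v\<in>UNIV. pairing_sign v y) =
      poly (\<Sum>v\<in>UNIV. monom (pairing_sign v y) (hamming_weight v)) 1"
    by (simp add: poly_sum poly_monom)
  \<comment> \<open>At 1 the factor \<open>[:1, - 1:]\<close> vanishes, so only weight 0 gives a
    nonzero value.\<close>
  then show ?thesis
    unfolding krawtchouk_generating_function
    by (auto simp: poly_power power_0_left hamming_weight_eq_0_iff)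
qed

section \<open>Trace duality\<close>

lemma subspace_trace_dual: "f2.subspace (trace_dual C)"
  by (auto simp: f2.subspace_def trace_dual_def f2_scale_def trace_form_add_right
      trace_form_zero_right)

lemma trace_dual_span: "trace_dual (f2.span S) = trace_dual S"
proof
  show "trace_dual (f2.span S) \<subseteq> trace_dual S"
    by (auto simp: trace_dual_def intro: f2.span_base)
  show "trace_dual S \<subseteq> trace_dual (f2.span S)"
  proof
    fix y assume y: "y \<in> trace_dual S"
    have "f2.subspace {x. trace_form x y = 0}"
      by (auto simp: f2.subspace_def trace_form_add_left trace_form_zero_left f2_scale_def)
    then have "f2.span S \<subseteq> {x. trace_form x y = 0}"
      using y by (intro f2.span_minimal) (auto simp: trace_dual_def)
    then show "y \<in> trace_dual (f2.span S)" by (auto simp: trace_dual_def)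
  qed
qed

lemma sum_pairing_sign_subspace:
  assumes "f2.subspace C"
  shows "(\<Sum>v\<in>C. pairing_sign v y) = (if y \<in> trace_dual C then real (card C) else 0)"
proof (cases "y \<in> trace_dual C")
  case True
  then have "(\<Sum>v\<in>C. pairing_sign v y) = (\<Sum>v\<in>C. 1)"
    by (intro sum.cong) (auto simp: trace_dual_def pairing_sign_def)
  with True show ?thesis by simp
next
  case False
  then obtain c where c: "c \<in> C" "pairing_sign c y = - 1"
    by (auto simp: trace_dual_def pairing_sign_def)
  \<comment> \<open>Translation by \<open>c\<close> permutes \<open>C\<close> and flips every sign,
    so the sum equals its own negative.\<close>
  have "(\<Sum>v\<in>C. pairing_sign v y) = (\<Sum>v\<in>C. pairing_sign (c + v) y)"
    using c f2.subspace_add[OF assms]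
    by (intro sum.reindex_bij_witness[of _ "(+) c" "(+) c"]) (auto simp: gf4_vec_add_add_cancel)
  also have "\<dots> = - (\<Sum>v\<in>C. pairing_sign v y)"
    by (simp add: pairing_sign_add_left c sum_negf)
  finally show ?thesis using False by simp
qed

lemma card_mult_card_trace_dual:
  fixes C :: "(gf4 ^ 'n) set"
  assumes "f2.subspace C"
  shows "card C * card (trace_dual C) = 4 ^ CARD('n)"
proof -
  have "real (card C * card (trace_dual C)) = (\<Sum>y\<in>UNIV. \<Sum>v\<in>C. pairing_sign v y)"
    by (simp add: sum_pairing_sign_subspace[OF assms] sum.If_cases)
  also have "\<dots> = (\<Sum>v\<in>C. \<Sum>y\<in>UNIV. pairing_sign y v)"
    by (subst sum.swap) (simp add: pairing_sign_commute)
  also have "\<dots> = (\<Sum>v\<in>C. if v = 0 then 4 ^ CARD('n) else 0)"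
    by (simp only: sum_pairing_sign_UNIV)
  also have "\<dots> = 4 ^ CARD('n)"
    using f2.subspace_0[OF assms] by simp
  finally show ?thesis by (metis of_nat_eq_iff of_nat_numeral of_nat_power)
qed

text \<open>One inclusion is the symmetry of the form; the size formula, applied to \<open>C\<close>
  and to its dual, makes the two cardinalities equal.\<close>

lemma trace_dual_trace_dual:
  fixes C :: "(gf4 ^ 'n) set"
  assumes "f2.subspace C"
  shows "trace_dual (trace_dual C) = C"
proof -
  have "C \<subseteq> trace_dual (trace_dual C)"
    by (auto simp: trace_dual_def trace_form_commute)
  moreover have "card C = card (trace_dual (trace_dual C))"
  proof -
    have "card C * card (trace_dual C) = card (trace_dual (trace_dual C)) * card (trace_dual C)"
      using card_mult_card_trace_dual[OF assms]
        card_mult_card_trace_dual[OF subspace_trace_dual[of C]] by (simp add: mult.commute)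
    moreover have "card (trace_dual C) \<noteq> 0"
      using card_mult_card_trace_dual[OF assms] by (metis mult_0_right power_not_zero zero_neq_numeral)
    ultimately show ?thesis by simp
  qed
  ultimately show ?thesis by (metis card_subset_eq finite)
qed

section \<open>Cosets and their characters\<close>

lemma mem_coset_iff: "u \<in> (+) v ` C \<longleftrightarrow> u + v \<in> (C :: (gf4 ^ 'n) set)"
proof
  assume "u + v \<in> C"
  moreover have "u = v + (u + v)" by (metis add.commute gf4_vec_add_add_cancel)
  ultimately show "u \<in> (+) v ` C" by blast
qed (metis add.assoc add.commute gf4_vec_add_add_cancel imageE)

lemma coset_eq_iff:
  assumes "f2.subspace (C :: (gf4 ^ 'n) set)"
  shows "(+) u ` C = (+) v ` C \<longleftrightarrow> u + v \<in> C"
proof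
  assume "(+) u ` C = (+) v ` C"
  moreover have "u \<in> (+) u ` C"
    using f2.subspace_0[OF assms] by (simp add: mem_coset_iff gf4_vec_add_self)
  ultimately show "u + v \<in> C" by (simp add: mem_coset_iff)
next
  assume uv: "u + v \<in> C"
  have "x + u \<in> C \<longleftrightarrow> x + v \<in> C" for x
  proof
    assume "x + u \<in> C"
    then have "(x + u) + (u + v) \<in> C" using uv f2.subspace_add[OF assms] by blast
    then show "x + v \<in> C" by (simp add: add.assoc gf4_vec_add_add_cancel)
  next
    assume "x + v \<in> C"
    then have "(x + v) + (u + v) \<in> C" using uv f2.subspace_add[OF assms] by blast
    then show "x + u \<in> C" by (metis add.assoc add.commute gf4_vec_add_add_cancel)
  qed
  then show "(+) u ` C = (+) v ` C" by (intro set_eqI) (simp only: mem_coset_iff)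
qed

text \<open>Two representatives differ by a word of \<open>C\<close>, which pairs to 0 with the
  dual, so the arbitrary choice made by \<open>SOME\<close> has no effect.\<close>

lemma coset_character_eq:
  assumes "f2.subspace C" "y \<in> trace_dual C"
  shows "coset_character C y ((+) v ` C) = pairing_sign v y"
proof -
  have "v \<in> (+) v ` C"
    using f2.subspace_0[OF assms(1)] by (simp add: mem_coset_iff gf4_vec_add_self)
  then have "(SOME a. a \<in> (+) v ` C) \<in> (+) v ` C" by (rule someI)
  then obtain a c where a: "(SOME a. a \<in> (+) v ` C) = v + c" "c \<in> C" by auto
  then have "trace_form (v + c) y = trace_form v y"
    using assms(2) by (simp add: trace_form_add_left trace_dual_def)
  then show ?thesis by (simp add: coset_character_def cosets_def pairing_sign_def a)
qed

lemma sum_over_cosets: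
  fixes g :: "(gf4 ^ 'n) set \<Rightarrow> real"
  assumes "f2.subspace C"
  shows "(\<Sum>v\<in>UNIV. g ((+) v ` C)) = real (card C) * (\<Sum>A\<in>cosets C. g A)"
proof -
  have "(\<Sum>v\<in>UNIV. g ((+) v ` C)) = (\<Sum>A\<in>cosets C. \<Sum>v\<in>{v. (+) v ` C = A}. g ((+) v ` C))"
    unfolding cosets_def using sum.image_gen[of UNIV "\<lambda>v. g ((+) v ` C)" "\<lambda>v. (+) v ` C"] by simp
  also have "\<dots> = (\<Sum>A\<in>cosets C. real (card C) * g A)"
  proof (rule sum.cong)
    fix A assume "A \<in> cosets C"
    then obtain w where w: "A = (+) w ` C" by (auto simp: cosets_def)
    then have "{v. (+) v ` C = A} = (+) w ` C"
      by (auto simp: coset_eq_iff[OF assms] mem_coset_iff[symmetric])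
    then have "card {v. (+) v ` C = A} = card C" by (simp add: card_image)
    moreover have "(\<Sum>v\<in>{v. (+) v ` C = A}. g ((+) v ` C)) = (\<Sum>v\<in>{v. (+) v ` C = A}. g A)"
      by (rule sum.cong) auto
    ultimately show "(\<Sum>v\<in>{v. (+) v ` C = A}. g ((+) v ` C)) = real (card C) * g A"
      by simp
  qed simp
  finally show ?thesis by (simp add: sum_distrib_left)
qed

lemma coset_character_orthogonal:
  fixes C :: "(gf4 ^ 'n) set"
  assumes C: "f2.subspace C" and y: "y \<in> trace_dual C" "y' \<in> trace_dual C"
  shows "(\<Sum>A\<in>cosets C. coset_character C y A * coset_character C y' A) =
    (if y = y' then real (card (trace_dual C)) else 0)"
proof -
  have "real (card C) * (\<Sum>A\<in>cosets C. coset_character C y A * coset_character C y' A) =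
      (\<Sum>v\<in>UNIV. pairing_sign v (y + y'))"
    unfolding sum_over_cosets[OF C, symmetric]
    by (simp add: coset_character_eq C y pairing_sign_add_right)
  also have "\<dots> = (if y = y' then real (card C) * real (card (trace_dual C)) else 0)"
    using card_mult_card_trace_dual[OF C]
    by (simp add: sum_pairing_sign_UNIV gf4_vec_add_eq_0_iff flip: of_nat_mult)
  finally have "real (card C) * (\<Sum>A\<in>cosets C. coset_character C y A * coset_character C y' A) =
      real (card C) * (if y = y' then real (card (trace_dual C)) else 0)" by simp
  moreover have "card C \<noteq> 0" using f2.subspace_0[OF C] by auto
  ultimately show ?thesis by simp
qed

lemma card_cosets:
  assumes "f2.subspace C"
  shows "card (cosets C) = card (trace_dual C)"
proof -
  have 0: "0 \<in> trace_dual C" using subspace_trace_dual f2.subspace_0 by blast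
  have "real (card (cosets C)) = (\<Sum>A\<in>cosets C. coset_character C 0 A * coset_character C 0 A)"
    by (simp add: coset_character_def trace_form_zero_right)
  also have "\<dots> = real (card (trace_dual C))"
    using coset_character_orthogonal[OF assms 0 0] by simp
  finally show ?thesis by simp
qed

text \<open>\<open>u + v\<close> pairs trivially with the whole dual exactly when it lies in the
  double dual, which is \<open>C\<close>: dual codewords separate cosets.\<close>

lemma coset_character_orthogonal_dual:
  assumes C: "f2.subspace C" and A: "A \<in> cosets C" "B \<in> cosets C"
  shows "(\<Sum>y\<in>trace_dual C. coset_character C y A * coset_character C y B) =
    (if A = B then real (card (trace_dual C)) else 0)"
proof -
  obtain u v where uv: "A = (+) u ` C" "B = (+) v ` C" using A by (auto simp: cosets_def)
  have "(\<Sum>y\<in>trace_dual C. coset_character C y A * coset_character C y B) =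
      (\<Sum>y\<in>trace_dual C. pairing_sign y (u + v))"
    by (intro sum.cong)
      (simp_all add: uv coset_character_eq[OF C] pairing_sign_add_right pairing_sign_commute)
  also have "\<dots> = (if u + v \<in> C then real (card (trace_dual C)) else 0)"
    by (simp add: sum_pairing_sign_subspace subspace_trace_dual trace_dual_trace_dual[OF C])
  finally show ?thesis by (simp add: uv coset_eq_iff[OF C])
qed

section \<open>The weight distribution of the dual code\<close>

lemma UNIV_11: "(UNIV :: 11 set) = {1, 2, 3, 4, 5, 6, 7, 8, 9, 10, 11}"
  by (rule card_subset_eq[symmetric]) simp_all

lemma vector_11:
  fixes x1 x2 x3 x4 x5 x6 x7 x8 x9 x10 x11 :: "'a::zero"
  defines "v \<equiv> vector [x1, x2, x3, x4, x5, x6, x7, x8, x9, x10, x11] :: 'a ^ 11"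
  shows "v $ 1 = x1" "v $ 2 = x2" "v $ 3 = x3" "v $ 4 = x4" "v $ 5 = x5" "v $ 6 = x6"
    "v $ 7 = x7" "v $ 8 = x8" "v $ 9 = x9" "v $ 10 = x10" "v $ 11 = x11"
  unfolding v_def vector_def by simp_all

text \<open>A separate constant shields parity expressions from the logical simplification of
  \<open>p \<noteq> q\<close>, so that \<open>bool_xor_ac\<close> can bring them to a normal
  form.\<close>

definition bool_xor :: "bool \<Rightarrow> bool \<Rightarrow> bool" where
  "bool_xor p q \<longleftrightarrow> p \<noteq> q"

lemma bool_xor_ac:
  "bool_xor (bool_xor p q) r = bool_xor p (bool_xor q r)" "bool_xor p q = bool_xor q p"
  "bool_xor p (bool_xor q r) = bool_xor q (bool_xor p r)"
  by (auto simp: bool_xor_def)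

lemma bool_xor_simps [simp]:
  "bool_xor False p = p" "bool_xor p False = p" "bool_xor True True = False" "bool_xor p p = False"
  "bool_xor p (bool_xor p q) = q"
  by (auto simp: bool_xor_def)

definition gf4_of :: "bool \<times> bool \<Rightarrow> gf4" where
  "gf4_of = (\<lambda>(a, b). GF4 (of_bool a) (of_bool b))"

lemma gf4_of_eq_0_iff: "gf4_of x = 0 \<longleftrightarrow> x = (False, False)"
  by (cases x) (simp add: gf4_of_def zero_gf4_def)

lemma gf4_of_eq_iff: "gf4_of x = gf4_of y \<longleftrightarrow> x = y"
  by (cases x; cases y) (simp add: gf4_of_def)

lemma gf4_of_surj: "\<exists>c. x = gf4_of c"
proof (cases x)
  case (GF4 p q)
  then have "x = gf4_of (p = 1, q = 1)"
    using bit_exhaust[of p] bit_exhaust[of q] by (auto simp: gf4_of_def)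
  then show ?thesis by blast
qed

lemma gf4_of_add: "gf4_of (a, False) + gf4_of (b, False) = gf4_of (bool_xor a b, False)"
  by (simp add: gf4_of_def plus_gf4_def bool_xor_def)

lemma gf4_trace_mult_square:
  "gf4_trace (0 * (gf4_of (a, b))\<^sup>2) = gf4_of (False, False)"
  "gf4_trace (1 * (gf4_of (a, b))\<^sup>2) = gf4_of (b, False)"
  "gf4_trace (\<omega> * (gf4_of (a, b))\<^sup>2) = gf4_of (a, False)"
  "gf4_trace (\<omega>\<^sup>2 * (gf4_of (a, b))\<^sup>2) = gf4_of (bool_xor a b, False)"
  by (cases a; cases b; simp add: gf4_trace_def gf4_of_def power2_eq_square times_gf4_def
      plus_gf4_def zero_gf4_def one_gf4_def omega_def bool_xor_def)+

definition vec_of :: "(bool \<times> bool) list \<Rightarrow> gf4 ^ 11" where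
  "vec_of bs = vector (map gf4_of bs)"

lemma vec_of_surj: "\<exists>bs. length bs = 11 \<and> y = vec_of bs"
proof -
  have "\<forall>i. \<exists>c. y $ i = gf4_of c" using gf4_of_surj by blast
  then have "\<exists>c. \<forall>i. y $ i = gf4_of (c i)" by (rule choice)
  then obtain c where "\<forall>i. y $ i = gf4_of (c i)" by blast
  then have "y = vec_of (map c [1, 2, 3, 4, 5, 6, 7, 8, 9, 10, 11])"
    (is "y = ?v")
  proof -
    have "\<forall>i\<in>UNIV. y $ i = ?v $ i"
      using \<open>\<forall>i. y $ i = gf4_of (c i)\<close> by (simp add: UNIV_11 vec_of_def vector_11)
    then show ?thesis by (simp add: vec_eq_iff)
  qed
  then show ?thesis by (intro exI conjI) simp_all
qed

lemma length_11_exhaust: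
  assumes "length xs = 11"
  obtains x1 x2 x3 x4 x5 x6 x7 x8 x9 x10 x11
  where "xs = [x1, x2, x3, x4, x5, x6, x7, x8, x9, x10, x11]"
  using assms by (auto simp: numeral_eq_Suc length_Suc_conv)

lemma map_vec_of_nth:
  assumes "length xs = 11"
  shows "map (($) (vec_of xs)) [1, 2, 3, 4, 5, 6, 7, 8, 9, 10, 11] = map gf4_of xs"
  by (rule length_11_exhaust[OF assms]) (simp add: vec_of_def vector_11)

lemma vec_of_inject:
  assumes "length xs = 11" "length ys = 11"
  shows "vec_of xs = vec_of ys \<longleftrightarrow> xs = ys"
proof
  assume "vec_of xs = vec_of ys"
  then have "map gf4_of xs = map gf4_of ys"
    using map_vec_of_nth[OF assms(1)] map_vec_of_nth[OF assms(2)] by simp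
  moreover have "inj gf4_of" by (auto intro: injI simp: gf4_of_eq_iff)
  ultimately show "xs = ys" by simp
qed simp

definition bits_weight :: "(bool \<times> bool) list \<Rightarrow> nat" where
  "bits_weight xs = length (filter (\<lambda>x. x \<noteq> (False, False)) xs)"

lemma hamming_weight_vec_of:
  assumes "length xs = 11"
  shows "hamming_weight (vec_of xs) = bits_weight xs"
proof -
  define js :: "11 list" where "js = [1, 2, 3, 4, 5, 6, 7, 8, 9, 10, 11]"
  have js: "set js = UNIV" "distinct js" unfolding js_def UNIV_11 by (simp_all only: list.set) simp
  have "hamming_weight (vec_of xs) = length (filter (\<lambda>i. vec_of xs $ i \<noteq> 0) js)"
    by (simp add: hamming_weight_def distinct_length_filter js)
  also have "\<dots> = length (filter (\<lambda>x. x \<noteq> 0) (map (($) (vec_of xs)) js))"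
    by (simp add: filter_map comp_def)
  also have "\<dots> = bits_weight xs"
    unfolding map_vec_of_nth[OF assms, folded js_def] bits_weight_def
    by (simp add: filter_map comp_def gf4_of_eq_0_iff)
  finally show ?thesis .
qed

fun bits_xor :: "(bool \<times> bool) list \<Rightarrow> (bool \<times> bool) list \<Rightarrow> (bool \<times> bool) list" where
  "bits_xor ((a, b) # xs) ((c, d) # ys) = (bool_xor a c, bool_xor b d) # bits_xor xs ys"
| "bits_xor _ _ = []"

text \<open>
  Solving the $12$ parity checks of $D^-$ for the coordinates not in \<open>free_bits\<close> (below) gives
  these generators of $E$; a pair $(a, b)$ stands for $a + b\omega$.
\<close>

definition E_gens :: "(bool \<times> bool) list list" where
  "E_gens =
  [[(False, True), (False, True), (True, True), (True, True), (True, False), (True, False),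
     (False, False), (True, False), (False, False), (False, True), (False, False)],
   [(False, False), (True, True), (True, False), (True, True), (False, True), (False, True),
     (False, False), (False, False), (False, False), (False, True), (False, False)],
   [(True, True), (False, True), (True, True), (False, False), (False, True), (False, False),
     (True, False), (False, False), (False, False), (False, True), (False, False)],
   [(False, True), (True, False), (False, False), (True, True), (True, True), (False, False),
     (False, True), (False, False), (False, False), (False, True), (False, False)],
   [(True, True), (True, True), (False, True), (True, False), (False, True), (False, False),
     (False, False), (False, True), (False, False), (False, False), (False, False)],
   [(True, False), (False, True), (True, False), (True, False), (False, True), (False, False),
     (False, False), (True, False), (True, False), (False, True), (False, False)],
   [(False, True), (False, True), (True, True), (True, False), (True, True), (False, False),
     (False, False), (False, False), (False, True), (False, False), (False, False)],
   [(True, True), (False, True), (False, False), (False, True), (True, True), (False, False),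
     (False, False), (True, False), (False, False), (True, False), (False, False)],
   [(True, True), (False, False), (True, False), (True, False), (True, True), (False, False),
     (False, False), (False, False), (False, False), (False, True), (True, False)],
   [(False, True), (True, True), (True, True), (False, True), (False, False), (False, False),
     (False, False), (True, False), (False, False), (False, False), (False, True)]]"

definition zero_bits :: "(bool \<times> bool) list" where
  "zero_bits = 
    [(False, False), (False, False), (False, False), (False, False), (False, False), (False, False),
     (False, False), (False, False), (False, False), (False, False), (False, False)]"

lemma length_zero_bits: "length zero_bits = 11"
  by (simp add: zero_bits_def)

text \<open>The last argument accumulates the sum, in step with the recursion of
  \<open>weight_count\<close>. An unselected generator is masked to zero and still added, so
  symbolic coefficients \<open>t\<close> need no case distinction.\<close>

fun combine :: "(bool \<times> bool) list list \<Rightarrow> bool list \<Rightarrow> (bool \<times> bool) list \<Rightarrow> (bool \<times> bool) list" where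
  "combine (g # gs) (t # ts) v = combine gs ts (bits_xor (map (\<lambda>(a, b). (t \<and> a, t \<and> b)) g) v)"
| "combine _ _ v = v"

text \<open>Each generator of \<open>D_minus\<close> gives one check. The bit written first is the
  one solved for: \<open>b10\<close> and \<open>a8\<close> from the two generators supported on the
  last six coordinates, then both bits of coordinates 1 to 5.\<close>

lemma vec_of_in_E_code_iff:
  "vec_of [(a1, b1), (a2, b2), (a3, b3), (a4, b4), (a5, b5), (a6, b6),
      (a7, b7), (a8, b8), (a9, b9), (a10, b10), (a11, b11)] \<in> E_code \<longleftrightarrow>
    \<not> bool_xor b10 (bool_xor a6 (bool_xor b6 (bool_xor a7 (bool_xor b7 (bool_xor a9 a11))))) \<and>
    \<not> bool_xor a8 (bool_xor a6 (bool_xor a9 (bool_xor a10 b11))) \<and>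
    \<not> bool_xor b1 (bool_xor b6 (bool_xor b8 (bool_xor a9 (bool_xor b9 (bool_xor a10 (bool_xor b10 b11)))))) \<and>
    \<not> bool_xor a1 (bool_xor a7 (bool_xor b8 (bool_xor a9 (bool_xor a10 a11)))) \<and>
    \<not> bool_xor b2 (bool_xor b7 (bool_xor b8 (bool_xor b9 (bool_xor a10 (bool_xor b10 (bool_xor a11 b11)))))) \<and>
    \<not> bool_xor a2 (bool_xor a6 (bool_xor b6 (bool_xor b7 (bool_xor a8 (bool_xor b8 (bool_xor a9 a10)))))) \<and>
    \<not> bool_xor b3 (bool_xor a6 (bool_xor a7 (bool_xor b8 (bool_xor b9 b11)))) \<and>
    \<not> bool_xor a3 (bool_xor a6 (bool_xor b7 (bool_xor a8 (bool_xor a9 (bool_xor b9 (bool_xor a10 b10)))))) \<and>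
    \<not> bool_xor b4 (bool_xor a6 (bool_xor a7 (bool_xor a8 (bool_xor b10 a11)))) \<and>
    \<not> bool_xor a4 (bool_xor a6 (bool_xor b6 (bool_xor b7 (bool_xor b8 (bool_xor a9 (bool_xor b9 a11)))))) \<and>
    \<not> bool_xor b5 (bool_xor a6 (bool_xor b6 (bool_xor a7 (bool_xor b7 (bool_xor a8 (bool_xor b8 (bool_xor b9 (bool_xor a11 b11)))))))) \<and>
    \<not> bool_xor a5 (bool_xor a6 (bool_xor b7 (bool_xor b9 (bool_xor a10 a11))))"
  unfolding E_code_def D_minus_def trace_dual_span
  by (simp only: trace_dual_def mem_Collect_eq ball_simps trace_form_def UNIV_11)
    (simp add: vec_of_def vector_11 gf4_trace_mult_square[simplified] gf4_of_add gf4_of_eq_0_iff bool_xor_ac)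

lemma vec_of_in_E_code_iff_combine:
  "vec_of [(a1, b1), (a2, b2), (a3, b3), (a4, b4), (a5, b5), (a6, b6),
      (a7, b7), (a8, b8), (a9, b9), (a10, b10), (a11, b11)] \<in> E_code \<longleftrightarrow>
    [(a1, b1), (a2, b2), (a3, b3), (a4, b4), (a5, b5), (a6, b6),
      (a7, b7), (a8, b8), (a9, b9), (a10, b10), (a11, b11)] =
    combine E_gens [a6, b6, a7, b7, b8, a9, b9, a10, a11, b11] zero_bits" (is "?l \<longleftrightarrow> ?r")
proof
  assume ?l
  then have "b10 = (bool_xor a6 (bool_xor b6 (bool_xor a7 (bool_xor b7 (bool_xor a9 a11))))) \<and>
    a8 = (bool_xor a6 (bool_xor a9 (bool_xor a10 b11))) \<and>
    b1 = (bool_xor b6 (bool_xor b8 (bool_xor a9 (bool_xor b9 (bool_xor a10 (bool_xor b10 b11)))))) \<and>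
    a1 = (bool_xor a7 (bool_xor b8 (bool_xor a9 (bool_xor a10 a11)))) \<and>
    b2 = (bool_xor b7 (bool_xor b8 (bool_xor b9 (bool_xor a10 (bool_xor b10 (bool_xor a11 b11)))))) \<and>
    a2 = (bool_xor a6 (bool_xor b6 (bool_xor b7 (bool_xor a8 (bool_xor b8 (bool_xor a9 a10)))))) \<and>
    b3 = (bool_xor a6 (bool_xor a7 (bool_xor b8 (bool_xor b9 b11)))) \<and>
    a3 = (bool_xor a6 (bool_xor b7 (bool_xor a8 (bool_xor a9 (bool_xor b9 (bool_xor a10 b10)))))) \<and>
    b4 = (bool_xor a6 (bool_xor a7 (bool_xor a8 (bool_xor b10 a11)))) \<and>
    a4 = (bool_xor a6 (bool_xor b6 (bool_xor b7 (bool_xor b8 (bool_xor a9 (bool_xor b9 a11)))))) \<and>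
    b5 = (bool_xor a6 (bool_xor b6 (bool_xor a7 (bool_xor b7 (bool_xor a8 (bool_xor b8 (bool_xor b9 (bool_xor a11 b11)))))))) \<and>
    a5 = (bool_xor a6 (bool_xor b7 (bool_xor b9 (bool_xor a10 a11))))"
    unfolding vec_of_in_E_code_iff by (simp only: bool_xor_def not_not)
  then show ?r
    \<comment> \<open>\<open>b10\<close> and \<open>a8\<close> still occur on the right-hand sides
      of other equations; substitution leaves only the ten free bits.\<close>
    by (elim conjE, hypsubst) (simp add: E_gens_def zero_bits_def bool_xor_ac)
next
  assume ?r
  then show ?l
    unfolding vec_of_in_E_code_iff by (simp add: E_gens_def zero_bits_def bool_xor_ac)
qed

text \<open>List positions start at 0, so \<open>bs ! 5\<close> is coordinate 6. The order is that
  of \<open>E_gens\<close>, where each generator has exactly one free bit set, the one at its own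
  position in this list.\<close>

definition free_bits :: "(bool \<times> bool) list \<Rightarrow> bool list" where
  "free_bits bs = [fst (bs ! 5), snd (bs ! 5), fst (bs ! 6), snd (bs ! 6), snd (bs ! 7),
     fst (bs ! 8), snd (bs ! 8), fst (bs ! 9), fst (bs ! 10), snd (bs ! 10)]"

text \<open>The generators are in systematic form, so a word shows its own coefficients. This makes
  the encoding injective.\<close>

lemma free_bits_combine:
  assumes "length ts = 10"
  shows "free_bits (combine E_gens ts zero_bits) = ts"
proof -
  obtain t1 t2 t3 t4 t5 t6 t7 t8 t9 t10 where "ts = [t1, t2, t3, t4, t5, t6, t7, t8, t9, t10]"
    using assms by (auto simp: numeral_eq_Suc length_Suc_conv)
  then show ?thesis by (simp add: free_bits_def E_gens_def zero_bits_def)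
qed

lemma length_bits_xor: "length (bits_xor xs ys) = min (length xs) (length ys)"
  by (induction xs ys rule: bits_xor.induct) auto

lemma bits_xor_zero:
  assumes "length g = length v"
  shows "bits_xor (map (\<lambda>(a, b). (False \<and> a, False \<and> b)) g) v = v"
  using assms by (induction g v rule: list_induct2) auto

lemma length_combine:
  assumes "\<forall>g\<in>set gs. length g = length v"
  shows "length (combine gs ts v) = length v"
  using assms by (induction gs ts v rule: combine.induct) (auto simp: length_bits_xor)

lemma length_E_gens: "g \<in> set E_gens \<Longrightarrow> length g = 11"
  by (auto simp: E_gens_def)

lemma vec_of_in_E_code_iff_free_bits:
  assumes "length bs = 11"
  shows "vec_of bs \<in> E_code \<longleftrightarrow> bs = combine E_gens (free_bits bs) zero_bits"
  using vec_of_in_E_code_iff_combine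
  by (rule_tac length_11_exhaust[OF assms]) (simp add: free_bits_def split_paired_all)

section \<open>Weight enumeration of the dual code\<close>

fun all_bools :: "nat \<Rightarrow> bool list list" where
  "all_bools 0 = [[]]"
| "all_bools (Suc n) = map ((#) False) (all_bools n) @ map ((#) True) (all_bools n)"

lemma set_all_bools: "set (all_bools n) = {ts. length ts = n}"
proof (induction n)
  case (Suc n)
  show ?case
  proof (intro set_eqI)
    fix ts show "ts \<in> set (all_bools (Suc n)) \<longleftrightarrow> ts \<in> {ts. length ts = Suc n}"
      by (cases ts) (auto simp: Suc)
  qed
qed simp

lemma distinct_all_bools: "distinct (all_bools n)"
  by (induction n) (auto simp: distinct_map)

text \<open>A binary tree with one level per generator: a partial sum is computed once and shared by
  all words below its node, and the 1024 leaves are then evaluated by plain rewriting.\<close>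

fun weight_count :: "(bool \<times> bool) list list \<Rightarrow> (bool \<times> bool) list \<Rightarrow> nat \<Rightarrow> nat" where
  "weight_count [] v w = (if bits_weight v = w then 1 else 0)"
| "weight_count (g # gs) v w = weight_count gs v w + weight_count gs (bits_xor g v) w"

lemma weight_count_eq:
  assumes "\<forall>g\<in>set gs. length g = length v"
  shows "weight_count gs v w =
    length (filter (\<lambda>ts. bits_weight (combine gs ts v) = w) (all_bools (length gs)))"
  using assms
proof (induction gs arbitrary: v)
  case (Cons g gs)
  have "(\<lambda>(a, b). (True \<and> a, True \<and> b)) = (\<lambda>x::bool \<times> bool. x)" by auto
  with Cons bits_xor_zero[of g v] show ?case by (simp add: length_bits_xor filter_map comp_def)
qed simp

lemma E_code_eq_image: "E_code = (\<lambda>ts. vec_of (combine E_gens ts zero_bits)) ` {ts. length ts = 10}"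
proof (intro set_eqI iffI)
  fix y assume y: "y \<in> E_code"
  obtain bs where bs: "length bs = 11" "y = vec_of bs" using vec_of_surj by blast
  then have "bs = combine E_gens (free_bits bs) zero_bits"
    using y vec_of_in_E_code_iff_free_bits by blast
  then show "y \<in> (\<lambda>ts. vec_of (combine E_gens ts zero_bits)) ` {ts. length ts = 10}"
    by (intro image_eqI[where x = "free_bits bs"]) (simp_all add: bs free_bits_def)
next
  fix y assume "y \<in> (\<lambda>ts. vec_of (combine E_gens ts zero_bits)) ` {ts. length ts = 10}"
  then obtain ts where ts: "length ts = 10" "y = vec_of (combine E_gens ts zero_bits)" by blast
  have "length (combine E_gens ts zero_bits) = 11"
    using length_combine[of E_gens zero_bits ts] length_E_gens by (simp add: length_zero_bits)
  then show "y \<in> E_code"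
    by (simp add: ts vec_of_in_E_code_iff_free_bits free_bits_combine)
qed

lemma card_E_code_filter:
  "card {y \<in> E_code. hamming_weight y = w} = weight_count E_gens zero_bits w"
proof -
  let ?f = "\<lambda>ts. combine E_gens ts zero_bits"
  have len: "length (?f ts) = 11" for ts
    using length_combine[of E_gens zero_bits ts] length_E_gens by (simp add: length_zero_bits)
  have "{y \<in> E_code. hamming_weight y = w} =
      (\<lambda>ts. vec_of (?f ts)) ` {ts. length ts = 10 \<and> bits_weight (?f ts) = w}"
    unfolding E_code_eq_image using len by (auto simp: hamming_weight_vec_of)
  moreover have "inj_on (\<lambda>ts. vec_of (?f ts)) {ts. length ts = 10 \<and> bits_weight (?f ts) = w}"
    using len free_bits_combine by (intro inj_onI) (metis (mono_tags) mem_Collect_eq vec_of_inject)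
  ultimately have "card {y \<in> E_code. hamming_weight y = w} =
      card {ts. length ts = 10 \<and> bits_weight (?f ts) = w}"
    by (simp add: card_image)
  also have "\<dots> = card ({ts. bits_weight (?f ts) = w} \<inter> set (all_bools 10))"
    unfolding set_all_bools by (rule arg_cong[where f = card]) auto
  also have "\<dots> = weight_count E_gens zero_bits w"
  proof -
    have "length E_gens = 10" by (simp add: E_gens_def)
    then show ?thesis
      using weight_count_eq[of E_gens zero_bits w] length_E_gens
      by (simp add: distinct_length_filter[OF distinct_all_bools] length_zero_bits)
  qed
  finally show ?thesis .
qed

lemma bits_weight_simps:
  "bits_weight [] = 0"
  "bits_weight ((False, False) # xs) = bits_weight xs"
  "bits_weight ((True, b) # xs) = Suc (bits_weight xs)"
  "bits_weight ((a, True) # xs) = Suc (bits_weight xs)"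
  by (simp_all add: bits_weight_def)

lemma card_E_code_weight_6: "card {y \<in> E_code. hamming_weight y = 6} = 198"
  unfolding card_E_code_filter E_gens_def zero_bits_def by (simp add: bits_weight_simps)

lemma card_E_code_weight_8: "card {y \<in> E_code. hamming_weight y = 8} = 495"
  unfolding card_E_code_filter E_gens_def zero_bits_def by (simp add: bits_weight_simps)

lemma card_E_code_weight_10: "card {y \<in> E_code. hamming_weight y = 10} = 330"
  unfolding card_E_code_filter E_gens_def zero_bits_def by (simp add: bits_weight_simps)

lemma card_E_code: "card E_code = 1024"
proof -
  have "inj_on (\<lambda>ts. vec_of (combine E_gens ts zero_bits)) {ts. length ts = 10}"
    using length_combine[of E_gens zero_bits] length_E_gens free_bits_combine
    by (intro inj_onI) (metis (mono_tags, lifting) length_zero_bits mem_Collect_eq vec_of_inject)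
  then have "card E_code = card (set (all_bools 10))"
    unfolding E_code_eq_image set_all_bools by (rule card_image)
  also have "\<dots> = length (all_bools 10)" by (rule distinct_card[OF distinct_all_bools])
  also have "\<dots> = 2 ^ 10"
  proof -
    have "length (all_bools n) = 2 ^ n" for n by (induction n) auto
    then show ?thesis .
  qed
  finally show ?thesis by simp
qed

section \<open>The coset classes\<close>

text \<open>Rows belong to the weights 0, 6, 8, 10, columns to the coset weights 0, 1, 2 and at
  least 3. The first three columns are Krawtchouk values for length 11; the last makes the rows sum
  to 1024, 0, 0, 0.\<close>

definition Q_matrix :: "nat \<Rightarrow> nat \<Rightarrow> real" where
  "Q_matrix i j = [[1, 33, 495, 495], [1, 9, 15, - 25], [1, 1, - 17, 15], [1, - 7, 15, - 9]] ! i ! j"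

text \<open>This is 1024 times the inverse of \<open>Q_matrix\<close>. Row 0 is the weight
  distribution of \<open>E_code\<close>, and the entry at \<open>j\<close>, \<open>i\<close> is
  \<open>Q_matrix i j\<close> times the \<open>i\<close>-th valency divided by the
  \<open>j\<close>-th multiplicity.\<close>

definition P_matrix :: "nat \<Rightarrow> nat \<Rightarrow> real" where
  "P_matrix j i = [[1, 198, 495, 330], [1, 54, 15, - 70], [1, 6, - 17, 10], [1, - 10, 15, - 6]] ! j ! i"

lemma sum_atMost_3: "(\<Sum>j\<le>3. f j) = f 0 + f 1 + f 2 + f (3::nat)"
  by (simp add: numeral_eq_Suc)

lemma le_3_cases: "(i::nat) \<le> 3 \<Longrightarrow> i = 0 \<or> i = 1 \<or> i = 2 \<or> i = 3"
  by auto

lemma Q_matrix_simps: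
  "Q_matrix 0 0 = 1" "Q_matrix 0 1 = 33" "Q_matrix 0 2 = 495" "Q_matrix 0 3 = 495"
  "Q_matrix 1 0 = 1" "Q_matrix 1 1 = 9" "Q_matrix 1 2 = 15" "Q_matrix 1 3 = - 25"
  "Q_matrix 2 0 = 1" "Q_matrix 2 1 = 1" "Q_matrix 2 2 = - 17" "Q_matrix 2 3 = 15"
  "Q_matrix 3 0 = 1" "Q_matrix 3 1 = - 7" "Q_matrix 3 2 = 15" "Q_matrix 3 3 = - 9"
  by (simp_all add: Q_matrix_def)

lemma P_matrix_simps:
  "P_matrix 0 0 = 1" "P_matrix 0 1 = 198" "P_matrix 0 2 = 495" "P_matrix 0 3 = 330"
  "P_matrix 1 0 = 1" "P_matrix 1 1 = 54" "P_matrix 1 2 = 15" "P_matrix 1 3 = - 70"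
  "P_matrix 2 0 = 1" "P_matrix 2 1 = 6" "P_matrix 2 2 = - 17" "P_matrix 2 3 = 10"
  "P_matrix 3 0 = 1" "P_matrix 3 1 = - 10" "P_matrix 3 2 = 15" "P_matrix 3 3 = - 6"
  by (simp_all add: P_matrix_def)

lemma Q_matrix_P_matrix:
  assumes "k \<le> 3" "i \<le> 3"
  shows "(\<Sum>j\<le>3. Q_matrix k j * P_matrix j i) = (if k = i then 1024 else 0)"
  using assms[THEN le_3_cases]
  by (elim disjE; simp only: sum_atMost_3 Q_matrix_simps P_matrix_simps; simp)

lemma P_matrix_Q_matrix:
  assumes "k \<le> 3" "i \<le> 3"
  shows "(\<Sum>j\<le>3. P_matrix k j * Q_matrix j i) = (if k = i then 1024 else 0)"
  using assms[THEN le_3_cases]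
  by (elim disjE; simp only: sum_atMost_3 Q_matrix_simps P_matrix_simps; simp)

text \<open>On \<open>E_code\<close> the last branch is reached by weight 10 only.\<close>

definition weight_class :: "nat \<Rightarrow> nat" where
  "weight_class w = (if w = 0 then 0 else if w = 6 then 1 else if w = 8 then 2 else 3)"

lemma subspace_D_minus: "f2.subspace D_minus"
  unfolding D_minus_def by (rule f2.subspace_span)

lemma subspace_E_code: "f2.subspace E_code"
  unfolding E_code_def by (rule subspace_trace_dual)

text \<open>The zero word and the three counts already add up to 1024, the size of the code, so all
  other weights are excluded without being counted.\<close>

lemma E_code_decomp:
  "E_code = {0} \<union> {y \<in> E_code. hamming_weight y = 6} \<union> {y \<in> E_code. hamming_weight y = 8} \<union>
    {y \<in> E_code. hamming_weight y = 10}" (is "_ = ?U")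
proof (rule card_subset_eq[symmetric])
  show "?U \<subseteq> E_code" using f2.subspace_0[OF subspace_E_code] by auto
  have "card ?U = 1 + 198 + 495 + 330"
    by (subst card_Un_disjoint; (subst card_Un_disjoint)?; (subst card_Un_disjoint)?;
      auto simp: card_E_code_weight_6 card_E_code_weight_8 card_E_code_weight_10)
  then show "card ?U = card E_code" by (simp add: card_E_code)
qed simp

lemma hamming_weight_E_code:
  assumes "y \<in> E_code"
  shows "hamming_weight y \<in> {0, 6, 8, 10}"
  using assms by (subst (asm) E_code_decomp) auto

lemma sum_E_code_weight:
  fixes f :: "nat \<Rightarrow> real"
  shows "(\<Sum>y\<in>E_code. f (hamming_weight y)) = f 0 + 198 * f 6 + 495 * f 8 + 330 * f 10"
proof -
  have "(\<Sum>y\<in>E_code. f (hamming_weight y)) =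
      (\<Sum>w\<in>{0, 6, 8, 10}. \<Sum>y\<in>{y \<in> E_code. hamming_weight y = w}. f (hamming_weight y))"
  proof (rule sum.group[symmetric])
    show "hamming_weight ` E_code \<subseteq> {0, 6, 8, 10}"
      by (rule image_subsetI) (rule hamming_weight_E_code)
  qed simp_all
  also have "\<dots> = (\<Sum>w\<in>{0, 6, 8, 10}. real (card {y \<in> E_code. hamming_weight y = w}) * f w)"
    by (intro sum.cong) auto
  also have "\<dots> = real (card {y \<in> E_code. hamming_weight y = 0}) * f 0 + 198 * f 6 + 495 * f 8 + 330 * f 10"
    by (simp add: card_E_code_weight_6 card_E_code_weight_8 card_E_code_weight_10)
  also have "{y \<in> E_code. hamming_weight y = 0} = {0}"
    using f2.subspace_0[OF subspace_E_code] by (auto simp: hamming_weight_eq_0_iff)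
  finally show ?thesis by simp
qed

lemma sum_pairing_sign_weight_E_code:
  assumes "y \<in> E_code" "k \<le> 2"
  shows "(\<Sum>v\<in>{v. hamming_weight v = k}. pairing_sign v y) =
    Q_matrix (weight_class (hamming_weight y)) k"
proof -
  have "coeff ([:1, 3:] ^ (11 - w) * [:1, - 1:] ^ w) k = Q_matrix (weight_class w) k"
    if "w \<in> {0, 6, 8, 10}" for w
  proof -
    have "k = 0 \<or> k = 1 \<or> k = 2" using assms(2) by auto
    then show ?thesis
      using that unfolding weight_class_def
      by (elim disjE insertE emptyE; simp add: Q_matrix_def eval_nat_numeral)
  qed
  then show ?thesis
    using hamming_weight_E_code[OF assms(1)] by (simp add: sum_pairing_sign_weight)
qed

text \<open>A nonzero word of weight at most 4 splits into two different vectors of weight at most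
  2, so this is minimum distance at least 5, in the form needed to tell cosets apart.\<close>

lemma D_minus_packing:
  assumes "hamming_weight u \<le> 2" "hamming_weight v \<le> 2" "u + v \<in> D_minus"
  shows "u = v"
proof -
  let ?B = "{v :: gf4 ^ 11. hamming_weight v \<le> 2}"
  \<comment> \<open>The values at the weights 0, 6, 8, 10 are 529, 25, -15, 9.\<close>
  define f where "f w = 1 + Q_matrix (weight_class w) 1 + Q_matrix (weight_class w) 2" for w
  have f: "(\<Sum>v\<in>?B. pairing_sign v y) = f (hamming_weight y)" if "y \<in> E_code" for y
  proof -
    have "(\<Sum>v\<in>?B. pairing_sign v y) =
        (\<Sum>k\<in>{0, 1, 2}. \<Sum>v\<in>{v \<in> ?B. hamming_weight v = k}. pairing_sign v y)"
      by (rule sum.group[symmetric]) auto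
    also have "\<dots> = (\<Sum>k\<in>{0, 1, 2}. \<Sum>v\<in>{v. hamming_weight v = k}. pairing_sign v y)"
      by (intro sum.cong) auto
    also have "\<dots> = (\<Sum>k\<in>{0, 1, 2}. Q_matrix (weight_class (hamming_weight y)) k)"
      using that by (intro sum.cong) (auto simp: sum_pairing_sign_weight_E_code)
    also have "\<dots> = f (hamming_weight y)"
      by (simp add: f_def weight_class_def Q_matrix_def)
    finally show ?thesis .
  qed
  have "real (card ?B) = (\<Sum>v\<in>?B. pairing_sign v 0)"
    by (simp add: pairing_sign_def trace_form_zero_right)
  also have "\<dots> = 529"
    using f[OF f2.subspace_0[OF subspace_E_code]] by (simp add: f_def weight_class_def Q_matrix_def)
  finally have card_B: "card ?B = 529" by simp
  let ?T = "{(u, v) \<in> ?B \<times> ?B. u + v \<in> D_minus}"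
  have "1024 * real (card ?T) = (\<Sum>(u, v)\<in>?B \<times> ?B. if u + v \<in> D_minus then 1024 else 0)"
    by (simp add: sum.If_cases case_prod_unfold Int_def mem_Times_iff)
  also have "\<dots> = (\<Sum>u\<in>?B. \<Sum>v\<in>?B. \<Sum>y\<in>E_code. pairing_sign u y * pairing_sign v y)"
  proof -
    have "(\<Sum>y\<in>E_code. pairing_sign u y * pairing_sign v y) =
        (if u + v \<in> D_minus then 1024 else 0)" for u v
    proof -
      have "(\<Sum>y\<in>E_code. pairing_sign u y * pairing_sign v y) = (\<Sum>y\<in>E_code. pairing_sign y (u + v))"
        by (simp add: pairing_sign_commute[of _ "u + v"] pairing_sign_add_left)
      also have "\<dots> = (if u + v \<in> trace_dual E_code then 1024 else 0)"
        by (simp add: sum_pairing_sign_subspace[OF subspace_E_code] card_E_code)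
      finally show ?thesis
        by (simp add: E_code_def trace_dual_trace_dual[OF subspace_D_minus])
    qed
    then show ?thesis by (simp add: sum.cartesian_product)
  qed
  also have "\<dots> = (\<Sum>y\<in>E_code. (\<Sum>v\<in>?B. pairing_sign v y)\<^sup>2)"
    by (simp add: power2_eq_square sum_product sum.swap[of _ E_code])
  also have "\<dots> = (\<Sum>y\<in>E_code. (f (hamming_weight y))\<^sup>2)"
    by (simp add: f)
  \<comment> \<open>This is 529^2 + 198 * 25^2 + 495 * 15^2 + 330 * 9^2.\<close>
  also have "\<dots> = 1024 * 529"
    unfolding sum_E_code_weight[of "\<lambda>w. (f w)\<^sup>2"]
    by (simp add: f_def weight_class_def Q_matrix_def)
  finally have "card ?T = 529" by simp
  moreover have "card ((\<lambda>v. (v, v)) ` ?B) = 529"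
    using card_B by (subst card_image) (auto intro: inj_onI)
  moreover have "(\<lambda>v. (v, v)) ` ?B \<subseteq> ?T"
    using f2.subspace_0[OF subspace_D_minus] by (auto simp: gf4_vec_add_self)
  ultimately have "(\<lambda>v. (v, v)) ` ?B = ?T"
    by (intro card_subset_eq) auto
  then have "(u, v) \<in> (\<lambda>v. (v, v)) ` ?B" using assms by auto
  then show ?thesis by auto
qed

section \<open>Cosets classified by minimum weight\<close>

definition coset_weight :: "(gf4 ^ 'n) set \<Rightarrow> nat" where
  "coset_weight A = Min (hamming_weight ` A)"

text \<open>No upper bound on coset weights is available at this point, so everything from 3 on is
  merged. In the coset graph this class turns out to be distance exactly 3 from
  \<open>D_minus\<close>.\<close>

definition coset_class :: "(gf4 ^ 'n) set \<Rightarrow> nat" where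
  "coset_class A = min 3 (coset_weight A)"

definition coset_sum :: "(gf4 ^ 'n) set \<Rightarrow> (gf4 ^ 'n) set \<Rightarrow> (gf4 ^ 'n) set" where
  "coset_sum A B = (\<lambda>(a, b). a + b) ` (A \<times> B)"

lemma coset_sum_coset:
  assumes "f2.subspace C"
  shows "coset_sum ((+) u ` C) ((+) v ` C) = (+) (u + v) ` C"
proof (intro set_eqI iffI)
  fix x assume "x \<in> coset_sum ((+) u ` C) ((+) v ` C)"
  then obtain c c' where c: "c \<in> C" "c' \<in> C" "x = (u + c) + (v + c')"
    by (auto simp: coset_sum_def)
  then have "x = (u + v) + (c + c')" by (simp add: add_ac)
  then show "x \<in> (+) (u + v) ` C" using c f2.subspace_add[OF assms] by blast
next
  fix x assume "x \<in> (+) (u + v) ` C"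
  then obtain c where c: "c \<in> C" "x = (u + v) + c" by blast
  then have "x = (\<lambda>(a, b). a + b) (u + c, v + 0)" by (simp add: add_ac)
  moreover have "(u + c, v + 0) \<in> (+) u ` C \<times> (+) v ` C"
    using c f2.subspace_0[OF assms] by blast
  ultimately show "x \<in> coset_sum ((+) u ` C) ((+) v ` C)"
    unfolding coset_sum_def by (rule image_eqI)
qed

lemma coset_weight_le: "v \<in> A \<Longrightarrow> coset_weight A \<le> hamming_weight v"
  unfolding coset_weight_def by (intro Min_le) auto

lemma coset_weight_attained:
  assumes "A \<noteq> {}"
  shows "\<exists>v\<in>A. hamming_weight v = coset_weight A"
proof -
  have "coset_weight A \<in> hamming_weight ` A"
    unfolding coset_weight_def using assms by (intro Min_in) auto
  then show ?thesis by force
qed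

lemma coset_self_mem: "f2.subspace C \<Longrightarrow> v \<in> (+) v ` C"
  by (simp add: mem_coset_iff gf4_vec_add_self f2.subspace_0)

text \<open>By the packing property a coset contains at most one vector of weight at most 2, so
  \<open>v\<close> itself attains the minimum.\<close>

lemma coset_weight_light:
  assumes "hamming_weight v \<le> 2"
  shows "coset_weight ((+) v ` D_minus) = hamming_weight v"
proof -
  define A where "A = (+) v ` D_minus"
  have v: "v \<in> A" unfolding A_def by (rule coset_self_mem[OF subspace_D_minus])
  then have "A \<noteq> {}" by blast
  from coset_weight_attained[OF this] obtain u where u: "u \<in> A" "hamming_weight u = coset_weight A"
    by blast
  then have "hamming_weight u \<le> 2" using coset_weight_le[OF v] assms by linarith
  moreover have "u + v \<in> D_minus" using u(1) by (simp add: A_def mem_coset_iff)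
  ultimately have "u = v" using D_minus_packing[OF _ assms] by blast
  then show ?thesis using u(2) unfolding A_def by simp
qed

lemma bij_betw_light_cosets:
  assumes "k \<le> 2"
  shows "bij_betw (\<lambda>v. (+) v ` D_minus) {v. hamming_weight v = k}
    {A \<in> cosets D_minus. coset_class A = k}"
  unfolding bij_betw_def
proof
  show "inj_on (\<lambda>v. (+) v ` D_minus) {v. hamming_weight v = k}"
  proof (rule inj_onI)
    fix u v assume uv: "u \<in> {v. hamming_weight v = k}" "v \<in> {v. hamming_weight v = k}"
      "(+) u ` D_minus = (+) v ` D_minus"
    then have "u + v \<in> D_minus" using coset_eq_iff[OF subspace_D_minus] by blast
    moreover have "hamming_weight u \<le> 2" "hamming_weight v \<le> 2" using uv assms by simp_all
    ultimately show "u = v" using D_minus_packing by blast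
  qed
  show "(\<lambda>v. (+) v ` D_minus) ` {v. hamming_weight v = k} = {A \<in> cosets D_minus. coset_class A = k}"
  proof (intro set_eqI iffI)
    fix A assume "A \<in> {A \<in> cosets D_minus. coset_class A = k}"
    then obtain u where u: "A = (+) u ` D_minus" "coset_weight A = k"
      using assms by (auto simp: cosets_def coset_class_def min_def split: if_splits)
    moreover have "A \<noteq> {}" using u(1) coset_self_mem[OF subspace_D_minus, of u] by blast
    ultimately obtain v where v: "v \<in> A" "hamming_weight v = k"
      using coset_weight_attained[of A] by auto
    then have "v + u \<in> D_minus" using u by (simp add: mem_coset_iff)
    then have "A = (+) v ` D_minus"
      using u coset_eq_iff[OF subspace_D_minus, of v u] by simp
    then show "A \<in> (\<lambda>v. (+) v ` D_minus) ` {v. hamming_weight v = k}" using v by blast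
  qed (use assms in \<open>auto simp: cosets_def coset_class_def coset_weight_light\<close>)
qed

lemma sum_coset_class:
  assumes y: "y \<in> E_code" and k: "k \<le> 3"
  shows "(\<Sum>A\<in>{A \<in> cosets D_minus. coset_class A = k}. coset_character D_minus y A) =
    Q_matrix (weight_class (hamming_weight y)) k"
proof -
  let ?S = "\<lambda>k. \<Sum>A\<in>{A \<in> cosets D_minus. coset_class A = k}. coset_character D_minus y A"
  let ?w = "weight_class (hamming_weight y)"
  have y': "y \<in> trace_dual D_minus" using y by (simp add: E_code_def)
  have light: "?S k = Q_matrix ?w k" if "k \<le> 2" for k
    unfolding sum.reindex_bij_betw[OF bij_betw_light_cosets[OF that], symmetric]
    using y that by (simp add: coset_character_eq[OF subspace_D_minus y'] sum_pairing_sign_weight_E_code)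
  have "(\<Sum>k\<le>3. ?S k) = (\<Sum>A\<in>cosets D_minus. coset_character D_minus y A)"
    by (rule sum.group) (auto simp: coset_class_def)
  \<comment> \<open>The word 0 gives the trivial character; orthogonality with it yields the total
    over all four classes, from which class 3 is obtained by subtraction.\<close>
  also have "\<dots> = (\<Sum>A\<in>cosets D_minus. coset_character D_minus y A * coset_character D_minus 0 A)"
    by (intro sum.cong) (auto simp: coset_character_def trace_form_zero_right)
  also have "\<dots> = (if y = 0 then 1024 else 0)"
    using coset_character_orthogonal[OF subspace_D_minus y', of 0] f2.subspace_0[OF subspace_E_code]
    by (simp add: E_code_def[symmetric] card_E_code)
  finally have total: "?S 0 + ?S 1 + ?S 2 + ?S 3 = (if y = 0 then 1024 else 0)"
    by (simp only: sum_atMost_3)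
  have "?S 3 = Q_matrix ?w 3"
    using total light[of 0] light[of 1] light[of 2] hamming_weight_E_code[OF y] hamming_weight_eq_0_iff[of y]
    by (auto simp: weight_class_def Q_matrix_def)
  then show ?thesis using light k le_3_cases[OF k] by auto
qed

lemma weight_class_E_code:
  assumes "y \<in> E_code"
  shows "weight_class (hamming_weight y) = 0 \<longleftrightarrow> y = 0" "weight_class (hamming_weight y) \<le> 3"
    "weight_class (hamming_weight y) = 1 \<longleftrightarrow> hamming_weight y = 6"
    "weight_class (hamming_weight y) = 2 \<longleftrightarrow> hamming_weight y = 8"
    "weight_class (hamming_weight y) = 3 \<longleftrightarrow> hamming_weight y = 10"
  using hamming_weight_E_code[OF assms] by (auto simp: weight_class_def hamming_weight_eq_0_iff)

lemma E_code_weight_class_surj: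
  assumes "j \<le> 3"
  shows "\<exists>y\<in>E_code. weight_class (hamming_weight y) = j"
proof -
  have ex: "\<exists>y\<in>E_code. weight_class (hamming_weight y) = weight_class w"
    if "card {y \<in> E_code. hamming_weight y = w} = Suc m" for w m
  proof -
    have "{y \<in> E_code. hamming_weight y = w} \<noteq> {}" using that by (intro notI) simp
    then show ?thesis by blast
  qed
  consider "j = 0" | "j = 1" | "j = 2" | "j = 3" using le_3_cases[OF assms] by blast
  then show ?thesis
  proof cases
    case 1
    then show ?thesis using f2.subspace_0[OF subspace_E_code] weight_class_E_code(1) by blast
  next
    case 2
    then show ?thesis using ex[of 6 197] by (simp add: card_E_code_weight_6 weight_class_def)
  next
    case 3
    then show ?thesis using ex[of 8 494] by (simp add: card_E_code_weight_8 weight_class_def)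
  next
    case 4
    then show ?thesis using ex[of 10 329] by (simp add: card_E_code_weight_10 weight_class_def)
  qed
qed

lemma coset_class_surj:
  assumes "j \<le> 3"
  shows "\<exists>A\<in>cosets D_minus. coset_class A = j"
proof (rule ccontr)
  assume "\<not> ?thesis"
  then have "{A \<in> cosets D_minus. coset_class A = j} = {}" by blast
  \<comment> \<open>An empty class has class sum 0 at the zero word, whereas row 0 of
    \<open>Q_matrix\<close> is positive.\<close>
  then have "Q_matrix (weight_class (hamming_weight (0 :: gf4 ^ 11))) j = 0"
    using sum_coset_class[OF f2.subspace_0[OF subspace_E_code] assms] by (simp only: sum.empty)
  then show False using le_3_cases[OF assms] by (auto simp: weight_class_def Q_matrix_def)
qed

lemma E_rel_eq:
  assumes "i \<le> 3"
  shows "E_rel i = {(x, x'). x \<in> E_code \<and> x' \<in> E_code \<and> weight_class (hamming_weight (x + x')) = i}"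
proof -
  have "x + x' \<in> E_code" if "x \<in> E_code" "x' \<in> E_code" for x x'
    using that f2.subspace_add[OF subspace_E_code] by blast
  note wc = weight_class_E_code[OF this]
  consider "i = 0" | "i = 1" | "i = 2" | "i = 3" using le_3_cases[OF assms] by blast
  then show ?thesis
  proof cases
    case 1
    then show ?thesis
      using wc(1) by (auto simp: E_rel_def gf4_vec_add_eq_0_iff gf4_vec_add_self)
  qed (simp_all add: E_rel_def wc(3-5) wc(3)[unfolded One_nat_def] cong: conj_cong)
qed

lemma E_code_scheme:
  "dual_eigenmatrices E_code (cosets D_minus) (\<lambda>y A. coset_character D_minus y A) 3 E_rel
    (\<lambda>x x'. weight_class (hamming_weight (x + x'))) coset_class P_matrix Q_matrix"
proof
  have add: "x + x' \<in> E_code" if "x \<in> E_code" "x' \<in> E_code" for x x'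
    using that f2.subspace_add[OF subspace_E_code] by blast
  have zero: "0 \<in> E_code" by (rule f2.subspace_0[OF subspace_E_code])
  show "finite E_code" "finite (cosets D_minus)" by simp_all
  show "E_code \<noteq> {}" using zero by blast
  show "E_rel i = {(x, x'). x \<in> E_code \<and> x' \<in> E_code \<and> weight_class (hamming_weight (x + x')) = i}"
    if "i \<le> 3" for i using that by (rule E_rel_eq)
  show "E_rel i \<noteq> {}" if i: "i \<le> 3" for i
  proof -
    obtain y where "y \<in> E_code" "weight_class (hamming_weight y) = i"
      using E_code_weight_class_surj[OF i] by blast
    then have "(0, y) \<in> E_rel i" using zero i by (simp add: E_rel_eq)
    then show ?thesis by blast
  qed
  show "weight_class (hamming_weight (x + x')) \<le> 3" for x x' :: "gf4 ^ 11"
    by (simp add: weight_class_def)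
  show "weight_class (hamming_weight (x + x')) = weight_class (hamming_weight (x' + x))"
    for x x' :: "gf4 ^ 11" by (simp add: add.commute)
  show "weight_class (hamming_weight (x + x')) = 0 \<longleftrightarrow> x = x'" for x x' :: "gf4 ^ 11"
    by (simp add: weight_class_def hamming_weight_eq_0_iff gf4_vec_add_eq_0_iff)
  show "\<exists>A\<in>cosets D_minus. coset_class A = j" if "j \<le> 3" for j
    using that by (rule coset_class_surj)
  show "coset_character D_minus x A * coset_character D_minus x A = 1" if "A \<in> cosets D_minus" for x A
    using that by (simp add: coset_character_def)
  show "(\<Sum>x\<in>E_code. coset_character D_minus x A * coset_character D_minus x B) =
      (if A = B then real (card E_code) else 0)" if "A \<in> cosets D_minus" "B \<in> cosets D_minus" for A B
    unfolding E_code_def using that by (rule coset_character_orthogonal_dual[OF subspace_D_minus])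
  show "(\<Sum>A\<in>{A \<in> cosets D_minus. coset_class A = j}.
      coset_character D_minus x A * coset_character D_minus x' A) =
      Q_matrix (weight_class (hamming_weight (x + x'))) j"
    if "x \<in> E_code" "x' \<in> E_code" "j \<le> 3" for x x' j
  proof -
    have "coset_character D_minus x A * coset_character D_minus x' A =
        coset_character D_minus (x + x') A" if A: "A \<in> cosets D_minus" for A
    proof -
      obtain v where "A = (+) v ` D_minus" using A by (auto simp: cosets_def)
      then show ?thesis
        using \<open>x \<in> E_code\<close> \<open>x' \<in> E_code\<close> add[OF \<open>x \<in> E_code\<close> \<open>x' \<in> E_code\<close>]
        by (simp add: E_code_def coset_character_eq[OF subspace_D_minus] pairing_sign_add_right)
    qed
    then have "(\<Sum>A\<in>{A \<in> cosets D_minus. coset_class A = j}.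
        coset_character D_minus x A * coset_character D_minus x' A) =
        (\<Sum>A\<in>{A \<in> cosets D_minus. coset_class A = j}. coset_character D_minus (x + x') A)"
      by (intro sum.cong) auto
    then show ?thesis using sum_coset_class[OF add[OF that(1,2)] that(3)] by simp
  qed
  show "(\<Sum>j\<le>3. Q_matrix k j * P_matrix j i) = (if k = i then real (card E_code) else 0)"
    if "k \<le> 3" "i \<le> 3" for k i using Q_matrix_P_matrix[OF that] by (simp add: card_E_code)
  show "Q_matrix k 0 = 1" if "k \<le> 3" for k
    using le_3_cases[OF that] by (auto simp: Q_matrix_def)
qed

section \<open>The transposed table: the scheme on the cosets\<close>

definition coset_dist :: "(gf4 ^ 'n) set \<Rightarrow> (gf4 ^ 'n) set \<Rightarrow> nat" where
  "coset_dist A B = coset_class (coset_sum A B)"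

lemma coset_dist_coset: "coset_dist ((+) u ` D_minus) ((+) v ` D_minus) = coset_class ((+) (u + v) ` D_minus)"
  by (simp add: coset_dist_def coset_sum_coset[OF subspace_D_minus])

lemma coset_class_eq_0_iff: "coset_class ((+) v ` D_minus) = 0 \<longleftrightarrow> v \<in> D_minus"
proof -
  define A where "A = (+) v ` D_minus"
  have "v \<in> A" unfolding A_def by (rule coset_self_mem[OF subspace_D_minus])
  then have "A \<noteq> {}" by blast
  have "coset_class A = 0 \<longleftrightarrow> coset_weight A = 0" by (simp add: coset_class_def min_def)
  also have "\<dots> \<longleftrightarrow> 0 \<in> A"
    using coset_weight_attained[OF \<open>A \<noteq> {}\<close>] coset_weight_le[of 0 A] hamming_weight_eq_0_iff
    by (metis hamming_weight_zero le_zero_eq)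
  also have "\<dots> \<longleftrightarrow> v \<in> D_minus" by (simp add: A_def mem_coset_iff)
  finally show ?thesis by (simp add: A_def)
qed

text \<open>For a fixed pair of cosets the row vector of class sums, multiplied by
  \<open>Q_matrix\<close>, is 1024 times the unit vector at the class of their sum. Multiplying by
  \<open>P_matrix\<close> identifies it with a row of \<open>P_matrix\<close>.\<close>

lemma coset_character_class_sum_dual:
  assumes A: "A \<in> cosets D_minus" "B \<in> cosets D_minus" and j: "j \<le> 3"
  shows "(\<Sum>y\<in>{y \<in> E_code. weight_class (hamming_weight y) = j}.
      coset_character D_minus y A * coset_character D_minus y B) = P_matrix (coset_dist A B) j"
proof -
  let ?\<psi> = "coset_character D_minus"
  define F where "F j = (\<Sum>y\<in>{y \<in> E_code. weight_class (hamming_weight y) = j}. ?\<psi> y A * ?\<psi> y B)" for j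
  obtain u v where uv: "A = (+) u ` D_minus" "B = (+) v ` D_minus" using A by (auto simp: cosets_def)
  define S where "S = (+) (u + v) ` D_minus"
  have S: "S \<in> cosets D_minus" by (auto simp: S_def cosets_def)
  have dist: "coset_dist A B = coset_class S" by (simp add: uv S_def coset_dist_coset)
  have \<psi>_mult: "?\<psi> y A * ?\<psi> y B = ?\<psi> y S" if "y \<in> E_code" for y
    using that by (simp add: E_code_def uv S_def coset_character_eq[OF subspace_D_minus] pairing_sign_add_left)
  have FQ: "(\<Sum>m\<le>3. F m * Q_matrix m i) = (if coset_class S = i then 1024 else 0)" if i: "i \<le> 3" for i
  proof -
    let ?H = "{C \<in> cosets D_minus. coset_class C = i}"
    have "(\<Sum>m\<le>3. F m * Q_matrix m i) =
        (\<Sum>m\<le>3. \<Sum>y\<in>{y \<in> E_code. weight_class (hamming_weight y) = m}.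
          ?\<psi> y A * ?\<psi> y B * Q_matrix (weight_class (hamming_weight y)) i)"
      unfolding F_def sum_distrib_right by (intro sum.cong) auto
    also have "\<dots> = (\<Sum>y\<in>E_code. ?\<psi> y A * ?\<psi> y B * Q_matrix (weight_class (hamming_weight y)) i)"
      using weight_class_E_code(2) by (intro sum.group) auto
    \<comment> \<open>The \<open>Q_matrix\<close> entry is turned back into a character sum over the
      cosets of class \<open>i\<close>, so that summation over \<open>y\<close> becomes an
      orthogonality relation testing whether \<open>S\<close> is among them.\<close>
    also have "\<dots> = (\<Sum>y\<in>E_code. \<Sum>C\<in>?H. ?\<psi> y S * ?\<psi> y C)"
      using i by (intro sum.cong) (auto simp: \<psi>_mult sum_coset_class[symmetric] sum_distrib_left)
    also have "\<dots> = (\<Sum>C\<in>?H. \<Sum>y\<in>E_code. ?\<psi> y S * ?\<psi> y C)"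
      by (rule sum.swap)
    also have "\<dots> = (\<Sum>C\<in>?H. if S = C then 1024 else 0)"
      using coset_character_orthogonal_dual[OF subspace_D_minus S]
      by (intro sum.cong) (auto simp: E_code_def[symmetric] card_E_code)
    also have "\<dots> = (if coset_class S = i then 1024 else 0)"
      using S by simp
    finally show ?thesis .
  qed
  have "1024 * F j = (\<Sum>m\<le>3. F m * (if m = j then 1024 else 0))"
    using j by (simp add: if_distrib[of "\<lambda>c. _ * c"] cong: if_cong)
  also have "\<dots> = (\<Sum>m\<le>3. F m * (\<Sum>i\<le>3. Q_matrix m i * P_matrix i j))"
    using j by (intro sum.cong) (auto simp: Q_matrix_P_matrix)
  also have "\<dots> = (\<Sum>i\<le>3. (\<Sum>m\<le>3. F m * Q_matrix m i) * P_matrix i j)"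
    by (simp add: sum_distrib_left sum_distrib_right mult.assoc) (rule sum.swap)
  also have "\<dots> = (\<Sum>i\<le>3. if i = coset_class S then 1024 * P_matrix i j else 0)"
    by (intro sum.cong) (auto simp: FQ)
  also have "\<dots> = 1024 * P_matrix (coset_class S) j"
    by (simp add: coset_class_def)
  finally show ?thesis by (simp add: F_def dist)
qed

text \<open>\<open>R\<close> stays open for two uses: with the classes of \<open>coset_dist\<close>,
  to obtain the intersection numbers that determine graph distances, and then with the graph
  distances themselves.\<close>

lemma coset_scheme:
  assumes R: "\<And>i. i \<le> 3 \<Longrightarrow> R i = {(A, B). A \<in> cosets D_minus \<and> B \<in> cosets D_minus \<and> coset_dist A B = i}"
  shows "dual_eigenmatrices (cosets D_minus) E_code (\<lambda>A y. coset_character D_minus y A) 3 R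
    coset_dist (\<lambda>y. weight_class (hamming_weight y)) Q_matrix P_matrix"
proof
  have card: "card (cosets D_minus) = 1024"
    using card_cosets[OF subspace_D_minus] by (simp add: E_code_def[symmetric] card_E_code)
  show "finite (cosets D_minus)" "finite E_code" by simp_all
  show "cosets D_minus \<noteq> {}" by (auto simp: cosets_def)
  show "R i = {(A, B). A \<in> cosets D_minus \<and> B \<in> cosets D_minus \<and> coset_dist A B = i}" if "i \<le> 3" for i
    using that by (rule R)
  show "R i \<noteq> {}" if i: "i \<le> 3" for i
  proof -
    obtain A where A: "A \<in> cosets D_minus" "coset_class A = i" using coset_class_surj[OF i] by blast
    then obtain v where v: "A = (+) v ` D_minus" by (auto simp: cosets_def)
    have "coset_dist ((+) 0 ` D_minus) A = i"
      using A(2) unfolding v coset_dist_coset by simp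
    moreover have "(+) 0 ` D_minus \<in> cosets D_minus" unfolding cosets_def by (rule rangeI)
    ultimately have "((+) 0 ` D_minus, A) \<in> R i"
      using A(1) unfolding R[OF i] by blast
    then show ?thesis by blast
  qed
  show "coset_dist A B \<le> 3" for A B :: "(gf4 ^ 11) set" by (simp add: coset_dist_def coset_class_def)
  show "coset_dist A B = coset_dist B A" if "A \<in> cosets D_minus" "B \<in> cosets D_minus" for A B
    using that by (auto simp: cosets_def coset_dist_coset add.commute)
  show "coset_dist A B = 0 \<longleftrightarrow> A = B" if AB: "A \<in> cosets D_minus" "B \<in> cosets D_minus" for A B
  proof -
    obtain u v where "A = (+) u ` D_minus" "B = (+) v ` D_minus" using AB by (auto simp: cosets_def)
    then show ?thesis
      by (simp add: coset_dist_coset coset_class_eq_0_iff coset_eq_iff[OF subspace_D_minus])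
  qed
  show "\<exists>y\<in>E_code. weight_class (hamming_weight y) = j" if "j \<le> 3" for j
    using that by (rule E_code_weight_class_surj)
  show "coset_character D_minus y A * coset_character D_minus y A = 1" if "A \<in> cosets D_minus" for y A
    using that by (simp add: coset_character_def)
  show "(\<Sum>A\<in>cosets D_minus. coset_character D_minus y A * coset_character D_minus y' A) =
      (if y = y' then real (card (cosets D_minus)) else 0)" if "y \<in> E_code" "y' \<in> E_code" for y y'
    using coset_character_orthogonal[OF subspace_D_minus] that
    by (simp add: E_code_def card_cosets[OF subspace_D_minus])
  show "(\<Sum>y\<in>{y \<in> E_code. weight_class (hamming_weight y) = j}.
      coset_character D_minus y A * coset_character D_minus y B) = P_matrix (coset_dist A B) j"
    if "A \<in> cosets D_minus" "B \<in> cosets D_minus" "j \<le> 3" for A B j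
    using that by (rule coset_character_class_sum_dual)
  show "(\<Sum>j\<le>3. P_matrix k j * Q_matrix j i) = (if k = i then real (card (cosets D_minus)) else 0)"
    if "k \<le> 3" "i \<le> 3" for k i using P_matrix_Q_matrix[OF that] by (simp add: card)
  show "P_matrix k 0 = 1" if "k \<le> 3" for k
    using le_3_cases[OF that] by (auto simp: P_matrix_def)
qed

section \<open>The coset graph and its distances\<close>

lemma coset_graph_eq:
  "coset_graph D_minus = {(A, B). A \<in> cosets D_minus \<and> B \<in> cosets D_minus \<and> coset_dist A B = 1}"
proof -
  have "A \<noteq> B \<and> (\<exists>a\<in>A. \<exists>b\<in>B. hamming_weight (a - b) = 1) \<longleftrightarrow> coset_dist A B = 1"
    if AB: "A \<in> cosets D_minus" "B \<in> cosets D_minus" for A B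
  proof -
    obtain u v where uv: "A = (+) u ` D_minus" "B = (+) v ` D_minus" using AB by (auto simp: cosets_def)
    define S where "S = coset_sum A B"
    have S: "S = (+) (u + v) ` D_minus" by (simp add: S_def uv coset_sum_coset[OF subspace_D_minus])
    have "u + v \<in> S" unfolding S by (rule coset_self_mem[OF subspace_D_minus])
    then have ne: "S \<noteq> {}" by blast
    have ex: "(\<exists>a\<in>A. \<exists>b\<in>B. hamming_weight (a - b) = 1) \<longleftrightarrow> (\<exists>s\<in>S. hamming_weight s = 1)"
      by (auto simp: S_def coset_sum_def gf4_vec_diff_eq_add)
    \<comment> \<open>A vector of weight 1 in the sum coset bounds the coset weight by 1;
      distinctness of the two cosets rules out weight 0.\<close>
    have neq: "A \<noteq> B \<longleftrightarrow> coset_weight S \<noteq> 0"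
    proof -
      have "coset_class S = 0 \<longleftrightarrow> coset_weight S = 0" by (auto simp: coset_class_def min_def)
      then show ?thesis
        using coset_class_eq_0_iff[of "u + v"] coset_eq_iff[OF subspace_D_minus, of u v]
        by (simp add: uv flip: S)
    qed
    have "coset_dist A B = 1 \<longleftrightarrow> coset_weight S = 1"
      by (simp add: coset_dist_def coset_class_def S_def min_def)
    also have "\<dots> \<longleftrightarrow> coset_weight S \<noteq> 0 \<and> (\<exists>s\<in>S. hamming_weight s = 1)"
    proof
      assume "coset_weight S = 1"
      then show "coset_weight S \<noteq> 0 \<and> (\<exists>s\<in>S. hamming_weight s = 1)"
        using coset_weight_attained[OF ne] by auto
    next
      assume a: "coset_weight S \<noteq> 0 \<and> (\<exists>s\<in>S. hamming_weight s = 1)"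
      then obtain s where "s \<in> S" "hamming_weight s = 1" by blast
      then show "coset_weight S = 1" using a coset_weight_le[of s S] by linarith
    qed
    finally show ?thesis using ex neq by blast
  qed
  then show ?thesis unfolding coset_graph_def by blast
qed

text \<open>The intersection numbers decide. A pair of class 0, 1, 2, 3 has 33, 2, 2, 0 common
  neighbours, so walks of length 2 join exactly the pairs of class at most 2. A pair of class 3 has
  15 intermediate cosets of class 2 from one end and class 1 from the other, hence a walk of length
  3.\<close>

lemma distance_rel_coset_graph:
  assumes "i \<le> 3"
  shows "distance_rel (cosets D_minus) (coset_graph D_minus) i =
    {(A, B). A \<in> cosets D_minus \<and> B \<in> cosets D_minus \<and> coset_dist A B = i}"
proof -
  let ?X = "cosets D_minus" and ?G = "coset_graph D_minus"
  interpret dual_eigenmatrices ?X E_code "\<lambda>A y. coset_character D_minus y A" 3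
    "\<lambda>i. {(A, B). A \<in> cosets D_minus \<and> B \<in> cosets D_minus \<and> coset_dist A B = i}"
    coset_dist "\<lambda>y. weight_class (hamming_weight y)" Q_matrix P_matrix
    by (rule coset_scheme) simp
  have card: "card ?X = 1024"
    using card_cosets[OF subspace_D_minus] by (simp add: E_code_def[symmetric] card_E_code)
  have common: "(\<exists>z\<in>?X. coset_dist x z = i \<and> coset_dist z y = j) \<longleftrightarrow>
      (\<Sum>m\<le>3. Q_matrix m i * Q_matrix m j * P_matrix (coset_dist x y) m) \<noteq> 0"
    if "x \<in> ?X" "y \<in> ?X" "i \<le> 3" "j \<le> 3" for x y i j
  proof -
    have "(\<exists>z\<in>?X. coset_dist x z = i \<and> coset_dist z y = j) \<longleftrightarrow>
        real (card {z \<in> ?X. coset_dist x z = i \<and> coset_dist z y = j}) \<noteq> 0"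
      by (auto simp: card_eq_0_iff)
    then show ?thesis using card_common[OF that(3,4,1,2)] card by simp
  qed
  have two: "(x, y) \<in> ?G O ?G \<longleftrightarrow> coset_dist x y \<noteq> 3" if "x \<in> ?X" "y \<in> ?X" for x y
  proof -
    have "(x, y) \<in> ?G O ?G \<longleftrightarrow> (\<exists>z\<in>?X. coset_dist x z = 1 \<and> coset_dist z y = 1)"
      using that by (auto simp: coset_graph_eq)
    also have "\<dots> \<longleftrightarrow> coset_dist x y \<noteq> 3"
      using common[OF that, of 1 1] le_3_cases[OF cl_le[OF that]]
      by (elim disjE) (simp_all only: sum_atMost_3 P_matrix_simps Q_matrix_simps, simp_all)
    finally show ?thesis .
  qed
  have three: "(x, y) \<in> (?G O ?G) O ?G" if xy: "x \<in> ?X" "y \<in> ?X" "coset_dist x y = 3" for x y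
  proof -
    have "\<exists>z\<in>?X. coset_dist x z = 2 \<and> coset_dist z y = 1"
      using common[OF xy(1,2), of 2 1] by (simp add: sum_atMost_3 P_matrix_def Q_matrix_def xy)
    then obtain z where z: "z \<in> ?X" "coset_dist x z = 2" "coset_dist z y = 1" by blast
    then have "(x, z) \<in> ?G O ?G" using two xy by simp
    moreover have "(z, y) \<in> ?G" using z xy by (simp add: coset_graph_eq)
    ultimately show ?thesis by blast
  qed
  have pow: "?G ^^ 1 = ?G" "?G ^^ 2 = ?G O ?G" "?G ^^ 3 = (?G O ?G) O ?G"
    by (simp_all add: numeral_eq_Suc)
  have one: "(x, y) \<in> ?G \<longleftrightarrow> coset_dist x y = 1" if "x \<in> ?X" "y \<in> ?X" for x y
    using that by (simp add: coset_graph_eq)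
  have zero: "(x, y) \<in> ?G ^^ 0 \<longleftrightarrow> coset_dist x y = 0" if "x \<in> ?X" "y \<in> ?X" for x y
    using cl_eq_0_iff[OF that] by simp
  have less: "(\<forall>j<0::nat. p j) \<longleftrightarrow> True" "(\<forall>j<1::nat. p j) \<longleftrightarrow> p 0"
    "(\<forall>j<2::nat. p j) \<longleftrightarrow> p 0 \<and> p 1" "(\<forall>j<3::nat. p j) \<longleftrightarrow> p 0 \<and> p 1 \<and> p 2" for p
    by (auto simp: numeral_eq_Suc less_Suc_eq)
  have "(x, y) \<in> ?G ^^ i \<and> (\<forall>j<i. (x, y) \<notin> ?G ^^ j) \<longleftrightarrow> coset_dist x y = i"
    if xy: "x \<in> ?X" "y \<in> ?X" for x y
  proof -
    consider "i = 0" | "i = 1" | "i = 2" | "i = 3" using le_3_cases[OF assms] by blast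
    then show ?thesis
    proof cases
      case 1
      show ?thesis unfolding 1 less using zero[OF xy] by blast
    next
      case 2
      show ?thesis unfolding 2 less pow zero[OF xy] one[OF xy] by linarith
    next
      case 3
      show ?thesis unfolding 3 less pow zero[OF xy] one[OF xy] two[OF xy] using cl_le[OF xy] by linarith
    next
      case 4
      show ?thesis unfolding 4 less pow zero[OF xy] one[OF xy] two[OF xy]
        using three[OF xy] by auto
    qed
  qed
  then show ?thesis unfolding distance_rel_def by blast
qed

section \<open>Krein parameters and the Krein array\<close>

lemma krein_parameters_Q_polynomial:
  assumes "i \<le> 3" "j \<le> 3" "k \<le> 3"
  defines "q \<equiv> (\<Sum>m\<le>3. Q_matrix m i * Q_matrix m j * P_matrix k m) / 1024"
  shows "(i > j + k \<or> j > i + k \<or> k > i + j \<longrightarrow> q = 0) \<and>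
    (i = j + k \<or> j = i + k \<or> k = i + j \<longrightarrow> q \<noteq> 0)"
  \<comment> \<open>All 64 triples are evaluated. The numbers are the intersection numbers of the
    coset graph, and the required zeros express the triangle inequality for its distance.\<close>
  using assms(1-3)[THEN le_3_cases] unfolding q_def sum_atMost_3
  by (elim disjE; simp only: Q_matrix_simps P_matrix_simps; simp)

lemma has_krein_array_E_code:
  assumes "krein_parameters E_code 3 e
    (\<lambda>i j k. (\<Sum>m\<le>3. Q_matrix m i * Q_matrix m j * P_matrix k m) / 1024)"
  shows "has_krein_array E_code 3 e [33, 30, 15] [1, 2, 15]"
  unfolding has_krein_array_def
proof (intro conjI exI)
  let ?q = "\<lambda>i j k. (\<Sum>m\<le>3. Q_matrix m i * Q_matrix m j * P_matrix k m) / 1024"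
  show "krein_parameters E_code 3 e ?q" by (rule assms)
  show "\<forall>i<3. ?q 1 (i + 1) i = [33, 30, 15] ! i"
  proof (intro allI impI)
    fix i :: nat assume "i < 3"
    then consider "i = 0" | "i = 1" | "i = 2" by linarith
    then show "?q 1 (i + 1) i = [33, 30, 15] ! i"
      by cases (simp_all add: sum_atMost_3 Q_matrix_def P_matrix_def)
  qed
  show "\<forall>i\<in>{1..3}. ?q 1 (i - 1) i = [1, 2, 15] ! (i - 1)"
  proof
    fix i :: nat assume "i \<in> {1..3}"
    then consider "i = 1" | "i = 2" | "i = 3" by (auto simp: le_Suc_eq numeral_eq_Suc)
    then show "?q 1 (i - 1) i = [1, 2, 15] ! (i - 1)"
      by cases (simp_all add: sum_atMost_3 Q_matrix_def P_matrix_def)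
  qed
qed simp_all

theorem theorem11:
  shows "card E_code = 2 ^ 10 \<and>
    hamming_weight ` (E_code - {0}) = {6, 8, 10} \<and>
    association_scheme (cosets D_minus) 3 (distance_rel (cosets D_minus) (coset_graph D_minus)) \<and>
    delsarte_dual D_minus 3 (distance_rel (cosets D_minus) (coset_graph D_minus)) E_rel \<and>
    (\<exists>e. Q_polynomial E_code 3 E_rel e \<and>
      has_krein_array E_code 3 e [33, 30, 15] [1, 2, 15] \<and>
      (\<forall>j\<le>3. multiplicity_of E_code (e j) = [1, 33, 495, 495] ! j)) \<and>
    (\<forall>i\<le>3. has_valency E_code (E_rel i) ([1, 198, 495, 330] ! i)) \<and>
    strongly_regular E_code (E_rel 2) (2 ^ 10) 495 238 240"
proof (intro conjI)
  let ?cl = "\<lambda>x x'. weight_class (hamming_weight (x + x'))"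
  interpret E: dual_eigenmatrices E_code "cosets D_minus" "\<lambda>y A. coset_character D_minus y A" 3 E_rel
    ?cl coset_class P_matrix Q_matrix
    by (rule E_code_scheme)
  interpret D: dual_eigenmatrices "cosets D_minus" E_code "\<lambda>A y. coset_character D_minus y A" 3
    "distance_rel (cosets D_minus) (coset_graph D_minus)"
    coset_dist "\<lambda>y. weight_class (hamming_weight y)" Q_matrix P_matrix
    by (rule coset_scheme) (rule distance_rel_coset_graph)
  have add: "x + x' \<in> E_code" if "x \<in> E_code" "x' \<in> E_code" for x x'
    using that f2.subspace_add[OF subspace_E_code] by blast
  have krein: "krein_parameters E_code 3 E.idem
      (\<lambda>i j k. (\<Sum>m\<le>3. Q_matrix m i * Q_matrix m j * P_matrix k m) / 1024)"
    using E.krein_parameters_idem by (simp add: card_E_code)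
  show "card E_code = 2 ^ 10" by (simp add: card_E_code)
  show "hamming_weight ` (E_code - {0}) = {6, 8, 10}"
  proof
    show "hamming_weight ` (E_code - {0}) \<subseteq> {6, 8, 10}"
    proof (rule image_subsetI)
      fix y assume "y \<in> E_code - {0}"
      then show "hamming_weight y \<in> {6, 8, 10}"
        using hamming_weight_E_code[of y] hamming_weight_eq_0_iff[of y] by simp
    qed
    have mem: "w \<in> hamming_weight ` (E_code - {0})"
      if "card {y \<in> E_code. hamming_weight y = w} \<noteq> 0" "w \<noteq> 0" for w
    proof -
      have "{y \<in> E_code. hamming_weight y = w} \<noteq> {}" using that(1) by (intro notI) simp
      then obtain y where "y \<in> E_code" "hamming_weight y = w" by blast
      moreover from this have "y \<noteq> 0" using that(2) by auto
      ultimately show ?thesis by blast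
    qed
    have "6 \<in> hamming_weight ` (E_code - {0})" "8 \<in> hamming_weight ` (E_code - {0})"
      "10 \<in> hamming_weight ` (E_code - {0})"
      by (rule mem; simp only: card_E_code_weight_6 card_E_code_weight_8 card_E_code_weight_10; simp)+
    then show "{6, 8, 10} \<subseteq> hamming_weight ` (E_code - {0})" by simp
  qed
  show "association_scheme (cosets D_minus) 3 (distance_rel (cosets D_minus) (coset_graph D_minus))"
    by (rule D.association_scheme)
  show "delsarte_dual D_minus 3 (distance_rel (cosets D_minus) (coset_graph D_minus)) E_rel"
    unfolding delsarte_dual_def
  proof (intro exI conjI allI impI)
    show "idempotent_ordering (cosets D_minus) 3 (distance_rel (cosets D_minus) (coset_graph D_minus)) D.idem"
      by (rule D.idempotent_ordering_idem)
    fix j :: nat assume j: "j \<le> 3"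
    \<comment> \<open>Both functions are 0 outside \<open>cosets D_minus\<close>, so they agree on
      the whole type, as membership in \<open>column_space\<close> requires.\<close>
    have "D.char_fun y = coset_character D_minus y" for y
      unfolding D.char_fun_def by (rule ext) (simp add: coset_character_def)
    then have "coset_character D_minus (x - y) \<in> column_space (cosets D_minus) (D.idem j) \<longleftrightarrow> ?cl x y = j"
      if "x \<in> E_code" "y \<in> E_code" for x y
      using D.char_fun_in_column_space_iff[OF j add[OF that]] by (simp add: gf4_vec_diff_eq_add)
    then show "E_rel j = {(x, y). x \<in> trace_dual D_minus \<and> y \<in> trace_dual D_minus \<and>
        coset_character D_minus (x - y) \<in> column_space (cosets D_minus) (D.idem j)}"
      unfolding E_rel_eq[OF j] E_code_def by blast
  qed
  show "\<exists>e. Q_polynomial E_code 3 E_rel e \<and> has_krein_array E_code 3 e [33, 30, 15] [1, 2, 15] \<and>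
      (\<forall>j\<le>3. multiplicity_of E_code (e j) = [1, 33, 495, 495] ! j)"
  proof (intro exI conjI allI impI)
    show "Q_polynomial E_code 3 E_rel E.idem"
      unfolding Q_polynomial_def
      using E.association_scheme E.idempotent_ordering_idem krein krein_parameters_Q_polynomial by blast
    show "has_krein_array E_code 3 E.idem [33, 30, 15] [1, 2, 15]"
      using krein by (rule has_krein_array_E_code)
    fix j :: nat assume j: "j \<le> 3"
    have "real (multiplicity_of E_code (E.idem j)) = real ([1, 33, 495, 495] ! j)"
      unfolding E.multiplicity_of_idem[OF j]
      using le_3_cases[OF j] by (elim disjE) (simp_all add: Q_matrix_def)
    then show "multiplicity_of E_code (E.idem j) = [1, 33, 495, 495] ! j" by simp
  qed
  show "\<forall>i\<le>3. has_valency E_code (E_rel i) ([1, 198, 495, 330] ! i)"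
    unfolding has_valency_def
  proof (intro allI impI ballI)
    fix i :: nat and x assume i: "i \<le> 3" and x: "x \<in> E_code"
    have "{y \<in> E_code. (x, y) \<in> E_rel i} = {y \<in> E_code. ?cl x y = i}"
      unfolding E_rel_eq[OF i] using x by blast
    then have "real (card {y \<in> E_code. (x, y) \<in> E_rel i}) = real ([1, 198, 495, 330] ! i)"
      using E.card_neighbours[OF i x] le_3_cases[OF i] by (elim disjE) (simp_all add: P_matrix_def)
    then show "card {y \<in> E_code. (x, y) \<in> E_rel i} = [1, 198, 495, 330] ! i" by simp
  qed
  show "strongly_regular E_code (E_rel 2) (2 ^ 10) 495 238 240"
    unfolding strongly_regular_def
  proof (intro conjI ballI impI)
    have E_rel_2: "(x, y) \<in> E_rel 2 \<longleftrightarrow> x \<in> E_code \<and> y \<in> E_code \<and> ?cl x y = 2" for x y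
      by (simp add: E_rel_eq)
    show "finite E_code" by simp
    show "card E_code = 2 ^ 10" by (simp add: card_E_code)
    show "E_rel 2 \<subseteq> E_code \<times> E_code" using E_rel_2 by auto
    show "sym (E_rel 2)" using E.association_scheme by (simp add: association_scheme_def)
    show "irrefl (E_rel 2)"
      unfolding irrefl_def
    proof (intro allI notI)
      fix x assume "(x, x) \<in> E_rel 2"
      then have "x \<in> E_code" "?cl x x = 2" unfolding E_rel_2 by blast+
      moreover have "?cl x x = 0" using E.cl_eq_0_iff calculation(1) by blast
      ultimately show False by linarith
    qed
    show "card {z \<in> E_code. (x, z) \<in> E_rel 2} = 495" if x: "x \<in> E_code" for x
    proof -
      have "{z \<in> E_code. (x, z) \<in> E_rel 2} = {z \<in> E_code. ?cl x z = 2}"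
        using x E_rel_2 by blast
      then have "real (card {z \<in> E_code. (x, z) \<in> E_rel 2}) = 495"
        using E.card_neighbours[of 2, OF _ x] by (simp add: P_matrix_def)
      then show ?thesis by simp
    qed
    fix x y assume xy: "x \<in> E_code" "y \<in> E_code" "x \<noteq> y"
    have "{z \<in> E_code. (x, z) \<in> E_rel 2 \<and> (y, z) \<in> E_rel 2} =
        {z \<in> E_code. ?cl x z = 2 \<and> ?cl z y = 2}"
      using xy E_rel_2 by (auto simp: add.commute)
    then have "real (card {z \<in> E_code. (x, z) \<in> E_rel 2 \<and> (y, z) \<in> E_rel 2}) =
        (\<Sum>m\<le>3. P_matrix m 2 * P_matrix m 2 * Q_matrix (?cl x y) m) / 1024"
      using E.card_common[of 2 2, OF _ _ xy(1,2)] by (simp add: card_E_code)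
    \<comment> \<open>Since \<open>P_matrix 1 2 = P_matrix 3 2\<close> and rows 1 to 3 of
      \<open>Q_matrix\<close> sum to 0, the sum depends only on \<open>Q_matrix (?cl x y) 2\<close>,
      which is 15 for classes 1 and 3 and -17 for class 2. So the two non-adjacent classes give the
      same count.\<close>
    also have "\<dots> = (if ?cl x y = 2 then 238 else 240)"
    proof -
      have "?cl x y = 1 \<or> ?cl x y = 2 \<or> ?cl x y = 3"
        using le_3_cases[OF E.cl_le[OF xy(1,2)]] E.cl_eq_0_iff[OF xy(1,2)] xy(3) by blast
      then show ?thesis
        by (elim disjE) (simp_all add: sum_atMost_3 P_matrix_def Q_matrix_def)
    qed
    finally have "real (card {z \<in> E_code. (x, z) \<in> E_rel 2 \<and> (y, z) \<in> E_rel 2}) =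
        real (if (x, y) \<in> E_rel 2 then 238 else 240)"
      using xy by (simp add: E_rel_2)
    then show "card {z \<in> E_code. (x, z) \<in> E_rel 2 \<and> (y, z) \<in> E_rel 2} =
        (if (x, y) \<in> E_rel 2 then 238 else 240)" by (simp only: of_nat_eq_iff)
  qed
qed

end
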